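(* Let $\alpha,\beta\in\{1,2,3,4,5\}$ and $p=(p_1,\dots,p_5),\,q=(q_1,\dots,q_5)\in\mathbb{C}^5$. Let $\pi^4_{jk}:\mathbf{U}(2)\to\mathbb{C}$ ($1\le j,k\le 5$) be the entries of the $5\times 5$ matrix $\pi^4$ whose columns are, in terms of the matrix entries $z_{ij}$ of $z\in\mathbf{U}(2)$, $$ \pi^4_{\cdot 1}=\begin{bmatrix} z_{11}^4\\ 4z_{11}^3z_{21}\\ 6z_{11}^2z_{21}^2\\ 4z_{11}z_{21}^3\\ z_{21}^4\end{bmatrix},\quad \pi^4_{\cdot 2}=\begin{bmatrix} z_{11}^3z_{12}\\ z_{11}^2(z_{11}z_{22}+3z_{12}z_{21})\\ 3z_{11}z_{21}(z_{11}z_{22}+z_{12}z_{21})\\ z_{21}^2(3z_{11}z_{22}+z_{12}z_{21})\\ z_{21}^3z_{22}\end{bmatrix}, $$ $$ \pi^4_{\cdot 3}=\begin{bmatrix} z_{11}^2z_{12}^2\\ 2z_{11}z_{12}(z_{11}z_{22}+z_{12}z_{21})\\ z_{11}^2z_{22}^2+4z_{11}z_{12}z_{21}z_{22}+z_{12}^2z_{21}^2\\ 2z_{21}z_{22}(z_{11}z_{22}+z_{12}z_{21})\\ z_{21}^2z_{22}^2\end{bmatrix}, $$ $$ \pi^4_{\cdot 4}=\begin{bmatrix} z_{11}z_{12}^3\\ z_{12}^2(3z_{11}z_{22}+z_{12}z_{21})\\ 3z_{12}z_{22}(z_{11}z_{22}+z_{12}z_{21})\\ z_{22}^2(z_{11}z_{22}+3z_{12}z_{21})\\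 z_{21}z_{22}^3\end{bmatrix},\quad \pi^4_{\cdot 5}=\begin{bmatrix} z_{12}^4\\ 4z_{12}^3z_{22}\\ 6z_{12}^2z_{22}^2\\ 4z_{12}z_{22}^3\\ z_{22}^4\end{bmatrix}. $$ Define $P,Q:\mathbf{U}(2)\to\mathbb{C}$ by $$ P(z)=\sum_{j=1}^5 p_j\,\pi^4_{j\alpha}(z),\qquad Q(z)=\sum_{k=1}^5 q_k\,\pi^4_{k\beta}(z). $$ Let the rational function $f(z)=P(z)/Q(z)$ be defined on the open and dense subset $W_Q=\{z\in\mathbf{U}(2)\mid Q(z)\neq 0\}$ of $\mathbf{U}(2)$. If $\alpha\neq\beta$, then $f$ is proper biharmonic whenever $p_4q_5\neq p_5q_4$ and $$ p_1q_5^4=q_4^3(4p_4q_5-3p_5q_4),\qquad q_1q_5^3=q_4^4, $$ $$ p_2q_5^3=q_4^2(3p_4q_5-2p_5q_4),\qquad q_2q_5^2=q_4^3, $$ $$ p_3q_5^2=q_4(2p_4q_5-p_5q_4),\qquad q_3q_5=q_4^2 . $$ The corresponding statement holds for the function induced on $\mathbf{SU}(2)$: under the same conditions, the restriction of $f$ to $W_Q\cap\mathbf{SU}(2)$ is proper biharmonic.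
   Context: $\mathbf{U}(2)=\{z\in\mathbf{GL}_2(\mathbb{C})\mid zz^*=I_2\}$ and $\mathbf{SU}(2)=\{z\in\mathbf{U}(2)\mid\det z=1\}$ carry the left-invariant Riemannian metrics induced by the scalar product $g(Z,W)=\mathrm{Re}\,\mathrm{trace}(ZW^* )$ on their Lie algebras (as subalgebras of $\mathfrak{gl}_2(\mathbb{C})$). For a complex-valued smooth function $f$ on a Riemannian manifold, $\tau(f)=\mathrm{div}(\nabla f)$ is the (complex-linearly extended) Laplace–Beltrami operator, $\tau^0(f)=f$ and $\tau^r(f)=\tau(\tau^{r-1}(f))$. The function $f$ is called proper biharmonic if $\tau^2(f)=0$ and $\tau(f)$ does not vanish identically. The function $f=P/Q$ is invariant under the circle action $z\mapsto e^{i\theta}z$ on $\mathbf{U}(2)$ (it is a quotient of homogeneous polynomials of the same degree in the $z_{ij}$), and the function induced on $\mathbf{SU}(2)$ is its restriction to $W_Q\cap\mathbf{SU}(2)$. *)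

theory Defs
  imports "HOL-Analysis.Analysis"
begin

section \<open>Matrix groups\<close>

definition conj_transpose :: "complex^'n^'m \<Rightarrow> complex^'m^'n" where
  "conj_transpose A = (\<chi> i j. cnj (A $ j $ i))"

definition unitary_group :: "(complex^'n::finite^'n) set" where
  "unitary_group = {z. invertible z \<and> z ** conj_transpose z = mat 1}"

definition special_unitary_group :: "(complex^'n::finite^'n) set" where
  "special_unitary_group = {z \<in> unitary_group. det z = 1}"


section \<open>Riemannian geometry of matrix groups with a left-invariant metric\<close>

text \<open>
  Throughout, \<open>G\<close> is a closed subgroup of the general linear group, hence an embedded submanifold
  of the space of matrices.  Functions and vector fields on \<open>G\<close> (or on an open subset of it) are
  represented by total functions on the space of all matrices; only the values on \<open>G\<close> matter.
  The tangent space consists of the velocity vectors of curves in \<open>G\<close>.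
\<close>

definition tangent_space :: "(complex^'n::finite^'n) set \<Rightarrow> complex^'n^'n \<Rightarrow> (complex^'n^'n) set"
  where "tangent_space G z =
    {V. \<exists>\<gamma> :: real \<Rightarrow> complex^'n^'n.
          (\<forall>t. \<gamma> t \<in> G) \<and> \<gamma> 0 = z \<and> (\<gamma> has_vector_derivative V) (at 0)}"

definition lie_algebra :: "(complex^'n::finite^'n) set \<Rightarrow> (complex^'n^'n) set" where
  "lie_algebra G = tangent_space G (mat 1)"

definition left_field :: "complex^'n::finite^'n \<Rightarrow> complex^'n^'n \<Rightarrow> complex^'n^'n" where
  "left_field Z = (\<lambda>z. z ** Z)"

definition scalar_product :: "complex^'n::finite^'n \<Rightarrow> complex^'n^'n \<Rightarrow> real" where
  "scalar_product Z W = Re (trace (Z ** conj_transpose W))"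

text \<open>The left-invariant metric: tangent vectors at \<open>z\<close> are moved to the identity by
  left translation with the inverse of \<open>z\<close>.\<close>

definition metric :: "complex^'n::finite^'n \<Rightarrow> complex^'n^'n \<Rightarrow> complex^'n^'n \<Rightarrow> real" where
  "metric z V W = scalar_product (matrix_inv z ** V) (matrix_inv z ** W)"

text \<open>The differential at \<open>z\<close> of a function on \<open>G\<close>, applied to a tangent vector \<open>V\<close> of \<open>G\<close> at \<open>z\<close>.
  A derivative within \<open>G\<close> is uniquely determined on the tangent space of \<open>G\<close> only.\<close>

definition differential ::
  "(complex^'n::finite^'n) set \<Rightarrow> (complex^'n^'n \<Rightarrow> 'b::real_normed_vector) \<Rightarrow>
    complex^'n^'n \<Rightarrow> complex^'n^'n \<Rightarrow> 'b"
  where "differential G f z V = frechet_derivative f (at z within G) V"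

definition gradient ::
  "(complex^'n::finite^'n) set \<Rightarrow> (complex^'n^'n \<Rightarrow> real) \<Rightarrow> complex^'n^'n \<Rightarrow> complex^'n^'n"
  where "gradient G f z =
    (THE V. V \<in> tangent_space G z \<and>
       (\<forall>W \<in> tangent_space G z. metric z V W = differential G f z W))"

text \<open>The Lie bracket of vector fields on a submanifold of a vector space.\<close>

definition bracket ::
  "(complex^'n::finite^'n) set \<Rightarrow> (complex^'n^'n \<Rightarrow> complex^'n^'n) \<Rightarrow>
    (complex^'n^'n \<Rightarrow> complex^'n^'n) \<Rightarrow> complex^'n^'n \<Rightarrow> complex^'n^'n"
  where "bracket G X Y z = differential G Y z (X z) - differential G X z (Y z)"

text \<open>The covariant derivative of \<open>Y\<close> along \<open>X\<close> for the Levi-Civita connection, given by the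
  Koszul formula.  It suffices to test against left-invariant fields, since they span every
  tangent space.\<close>

definition levi_civita ::
  "(complex^'n::finite^'n) set \<Rightarrow> (complex^'n^'n \<Rightarrow> complex^'n^'n) \<Rightarrow>
    (complex^'n^'n \<Rightarrow> complex^'n^'n) \<Rightarrow> complex^'n^'n \<Rightarrow> complex^'n^'n"
  where "levi_civita G X Y z =
    (THE V. V \<in> tangent_space G z \<and>
       (\<forall>W \<in> left_field ` lie_algebra G.
          2 * metric z V (W z) =
              differential G (\<lambda>w. metric w (Y w) (W w)) z (X z)
            + differential G (\<lambda>w. metric w (X w) (W w)) z (Y z)
            - differential G (\<lambda>w. metric w (X w) (Y w)) z (W z)
            + metric z (bracket G X Y z) (W z)
            - metric z (bracket G X W z) (Y z)
            - metric z (bracket G Y W z) (X z)))"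

definition orthonormal_basis ::
  "(complex^'n::finite^'n) set \<Rightarrow> (complex^'n^'n) set \<Rightarrow> bool"
  where "orthonormal_basis L B \<longleftrightarrow>
    B \<subseteq> L \<and> span B = L \<and>
    (\<forall>X\<in>B. \<forall>Y\<in>B. scalar_product X Y = (if X = Y then 1 else 0))"

text \<open>The divergence of \<open>Y\<close> is the trace of the endomorphism taking a tangent vector \<open>V\<close> to the
  covariant derivative of \<open>Y\<close> along \<open>V\<close>.  It is computed in a left-invariant orthonormal frame, on
  whose choice the value does not depend.\<close>

definition divergence ::
  "(complex^'n::finite^'n) set \<Rightarrow> (complex^'n^'n \<Rightarrow> complex^'n^'n) \<Rightarrow> complex^'n^'n \<Rightarrow> real"
  where "divergence G Y z =
    (\<Sum>E \<in> (SOME B. orthonormal_basis (lie_algebra G) B).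
       metric z (levi_civita G (left_field E) Y z) (left_field E z))"

definition laplace_beltrami_real ::
  "(complex^'n::finite^'n) set \<Rightarrow> (complex^'n^'n \<Rightarrow> real) \<Rightarrow> complex^'n^'n \<Rightarrow> real"
  where "laplace_beltrami_real G f = divergence G (gradient G f)"

definition laplace_beltrami ::
  "(complex^'n::finite^'n) set \<Rightarrow> (complex^'n^'n \<Rightarrow> complex) \<Rightarrow> complex^'n^'n \<Rightarrow> complex"
  where "laplace_beltrami G f z =
    of_real (laplace_beltrami_real G (\<lambda>w. Re (f w)) z)
    + \<i> * of_real (laplace_beltrami_real G (\<lambda>w. Im (f w)) z)"


section \<open>Smooth and proper biharmonic functions\<close>

text \<open>Class \<open>C\<^sup>k\<close> on an open subset \<open>W\<close> of \<open>G\<close>, expressed by the derivatives along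
  left-invariant vector fields, which form a global frame of the tangent bundle.\<close>

primrec Ck_on ::
  "nat \<Rightarrow> (complex^'n::finite^'n) set \<Rightarrow> (complex^'n^'n) set \<Rightarrow> (complex^'n^'n \<Rightarrow> complex) \<Rightarrow> bool"
  where
    "Ck_on 0 G W f \<longleftrightarrow> continuous_on W f"
  | "Ck_on (Suc k) G W f \<longleftrightarrow>
       (\<forall>z\<in>W. f differentiable (at z within G)) \<and>
       (\<forall>Z\<in>lie_algebra G. Ck_on k G W (\<lambda>z. differential G f z (left_field Z z)))"

definition smooth_on ::
  "(complex^'n::finite^'n) set \<Rightarrow> (complex^'n^'n) set \<Rightarrow> (complex^'n^'n \<Rightarrow> complex) \<Rightarrow> bool"
  where "smooth_on G W f \<longleftrightarrow> (\<forall>k. Ck_on k G W f)"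

definition proper_biharmonic_on ::
  "(complex^'n::finite^'n) set \<Rightarrow> (complex^'n^'n) set \<Rightarrow> (complex^'n^'n \<Rightarrow> complex) \<Rightarrow> bool"
  where "proper_biharmonic_on G W f \<longleftrightarrow>
    openin (top_of_set G) W \<and> smooth_on G W f \<and>
    (\<forall>z\<in>W. (laplace_beltrami G ^^ 2) f z = 0) \<and>
    (\<exists>z\<in>W. laplace_beltrami G f z \<noteq> 0)"


section \<open>The representation \<open>\<pi>\<^sup>4\<close>\<close>

text \<open>The inner vectors are the columns.  In the index type \<open>5\<close>, the numerals \<open>1, \<dots>, 5\<close> denote
  its five distinct elements (with \<open>5 = 0\<close>).\<close>

definition pi4 :: "complex^2^2 \<Rightarrow> complex^5^5" where
  "pi4 z =
    (let z11 = z $ 1 $ 1; z12 = z $ 1 $ 2; z21 = z $ 2 $ 1; z22 = z $ 2 $ 2 in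
     transpose (vector [
       vector [z11^4,
               4 * z11^3 * z21,
               6 * z11^2 * z21^2,
               4 * z11 * z21^3,
               z21^4],
       vector [z11^3 * z12,
               z11^2 * (z11 * z22 + 3 * z12 * z21),
               3 * z11 * z21 * (z11 * z22 + z12 * z21),
               z21^2 * (3 * z11 * z22 + z12 * z21),
               z21^3 * z22],
       vector [z11^2 * z12^2,
               2 * z11 * z12 * (z11 * z22 + z12 * z21),
               z11^2 * z22^2 + 4 * z11 * z12 * z21 * z22 + z12^2 * z21^2,
               2 * z21 * z22 * (z11 * z22 + z12 * z21),
               z21^2 * z22^2],
       vector [z11 * z12^3,
               z12^2 * (3 * z11 * z22 + z12 * z21),
               3 * z12 * z22 * (z11 * z22 + z12 * z21),
               z22^2 * (z11 * z22 + 3 * z12 * z21),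
               z21 * z22^3],
       vector [z12^4,
               4 * z12^3 * z22,
               6 * z12^2 * z22^2,
               4 * z12 * z22^3,
               z22^4]]))"

definition pi4_comb :: "complex^5 \<Rightarrow> 5 \<Rightarrow> complex^2^2 \<Rightarrow> complex" where
  "pi4_comb p \<alpha> z = (\<Sum>j\<in>UNIV. p $ j * pi4 z $ j $ \<alpha>)"

end

theory Submission
  imports Defs
begin

text \<open>
  On a group \<open>G\<close> of unitary matrices the left-invariant metric is the restriction of the Euclidean
  scalar product and is bi-invariant, so the Koszul formula gives \<open>\<tau>(f) = \<Sum> E(E(f))\<close>, summed over
  the left-invariant fields of any orthonormal basis of the Lie algebra.

  The equations force \<open>q\<^sub>5 \<noteq> 0\<close>; put \<open>t = q\<^sub>4/q\<^sub>5\<close> and \<open>s = p\<^sub>4 - p\<^sub>5 t \<noteq> 0\<close>.  The columns of \<open>\<pi>\<^sup>4\<close> are the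
  coefficients of binary quartic forms, and with the column sums \<open>u = t z\<^sub>1\<^sub>1 + z\<^sub>2\<^sub>1\<close>, \<open>v = t z\<^sub>1\<^sub>2 + z\<^sub>2\<^sub>2\<close>
  and \<open>a = \<alpha> - 1\<close>, \<open>b = \<beta> - 1\<close> one gets \<open>Q = q\<^sub>5 u^(4 - b) v^b\<close>, while \<open>P\<close> is \<open>p\<^sub>5 + s \<partial>/\<partial>t\<close> applied to
  \<open>u^(4 - a) v^a\<close>.  If \<open>b < a\<close>, then \<open>P/Q\<close> has the form \<open>A(w) + B(w) g + C(w) d\<close> with polynomials
  \<open>A\<close>, \<open>B\<close>, \<open>C\<close>, where \<open>w = v/u\<close>, \<open>g = z\<^sub>1\<^sub>1/u\<close> and \<open>d = det z/u\<^sup>2\<close>.  The derivatives of \<open>w\<close>, \<open>g\<close>, \<open>d\<close> along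
  left-invariant fields are again polynomials in \<open>w\<close>, \<open>g\<close>, \<open>d\<close>, and the Laplacian of such a function
  turns out to be \<open>2 B'(w) d\<close>.  Applying this twice gives \<open>\<tau>\<^sup>2(f) = 0\<close>.  The case \<open>a < b\<close> is the same
  with the two columns of \<open>z\<close> exchanged.
\<close>

section \<open>Calculus on subgroups of the unitary group\<close>

text \<open>Points of \<open>G\<close> close to \<open>z\<close> lie in \<open>W\<close>, so the
  filter \<open>at z within G\<close> does not see values outside \<open>W\<close>.\<close>

lemma has_derivative_cong_openin:
  assumes "(f has_derivative D) (at z within G)" and "openin (top_of_set G) W" "z \<in> W"
    and "\<And>w. w \<in> W \<Longrightarrow> f w = g w"
  shows "(g has_derivative D) (at z within G)"
proof -
  obtain e where "e > 0" and e: "\<And>w. w \<in> G \<Longrightarrow> dist w z < e \<Longrightarrow> w \<in> W"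
    using assms(2,3) by (auto simp: openin_euclidean_subtopology_iff)
  moreover have "z \<in> G"
    using assms(2,3) openin_subset by fastforce
  ultimately show ?thesis
    using assms(1,4) by (auto intro: has_derivative_transform_within)
qed

text \<open>The curve stays in \<open>G\<close>, so a derivative within \<open>G\<close> suffices
  for the chain rule.\<close>

lemma has_vector_derivative_along_curve:
  assumes "(f has_derivative D) (at (\<gamma> 0) within G)" and "(\<gamma> has_vector_derivative V) (at (0::real))"
    and "\<And>t. \<gamma> t \<in> G"
  shows "((\<lambda>t. f (\<gamma> t)) has_vector_derivative D V) (at 0)"
proof -
  have "(f has_derivative D) (at (\<gamma> 0) within range \<gamma>)"
    using assms(1,3) by (blast intro: has_derivative_subset)
  then show ?thesis
    using vector_derivative_diff_chain_within[OF assms(2)] by (simp add: o_def)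
qed

text \<open>Difference quotients stay in \<open>S\<close>, and a subspace of a Euclidean space is
  closed.\<close>

lemma has_vector_derivative_in_subspace:
  fixes \<phi> :: "real \<Rightarrow> 'a::euclidean_space"
  assumes "(\<phi> has_vector_derivative v) (at 0)" and "\<And>t. \<phi> t \<in> S" and "subspace S"
  shows "v \<in> S"
proof (rule Lim_in_closed_set)
  show "closed S"
    using assms(3) by (rule closed_subspace)
  show "((\<lambda>h. (\<phi> h - \<phi> 0) /\<^sub>R h) \<longlongrightarrow> v) (at 0)"
  proof -
    have "((\<lambda>h. inverse (norm h) *\<^sub>R (\<phi> h - \<phi> 0 - h *\<^sub>R v)) \<longlongrightarrow> 0) (at 0)"
      using assms(1) by (simp add: has_vector_derivative_def has_derivative_def divide_inverse_commute)
    then have "((\<lambda>h. norm (inverse h *\<^sub>R (\<phi> h - \<phi> 0 - h *\<^sub>R v))) \<longlongrightarrow> 0) (at 0)"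
      by (auto dest: tendsto_norm_zero)
    then have "((\<lambda>h. inverse h *\<^sub>R (\<phi> h - \<phi> 0 - h *\<^sub>R v)) \<longlongrightarrow> 0) (at 0)"
      using tendsto_norm_zero_iff by blast
    then have "((\<lambda>h. (\<phi> h - \<phi> 0) /\<^sub>R h - v) \<longlongrightarrow> 0) (at 0)"
      by (rule Lim_transform_eventually)
         (auto simp: eventually_at_filter scaleR_right_diff_distrib)
    then show ?thesis
      by (simp add: Lim_null[of _ v])
  qed
  show "\<forall>\<^sub>F h in at 0. (\<phi> h - \<phi> 0) /\<^sub>R h \<in> S"
    using assms(2,3) by (auto intro!: always_eventually subspace_scale subspace_diff)
  show "at (0::real) \<noteq> bot"
    by simp
qed

section \<open>Matrix product, conjugate transpose and the Euclidean scalar product\<close>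

lemma bounded_bilinear_matrix_mult:
  "bounded_bilinear ((**) :: complex^'n::finite^'m::finite \<Rightarrow> complex^'k::finite^'n \<Rightarrow> complex^'k^'m)"
  unfolding bilinear_conv_bounded_bilinear[symmetric] bilinear_def
  by (auto intro!: linearI simp: vec_eq_iff matrix_matrix_mult_def scaleR_sum_right
      sum.distrib algebra_simps)

interpretation matrix_mult: bounded_bilinear
  "(**) :: complex^'n::finite^'m::finite \<Rightarrow> complex^'k::finite^'n \<Rightarrow> complex^'k^'m"
  by (rule bounded_bilinear_matrix_mult)

lemma conj_transpose_mult: "conj_transpose (A ** B) = conj_transpose B ** conj_transpose A"
  by (simp add: vec_eq_iff conj_transpose_def matrix_matrix_mult_def mult.commute)

lemma conj_transpose_conj_transpose [simp]: "conj_transpose (conj_transpose A) = A"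
  by (simp add: vec_eq_iff conj_transpose_def)

lemma conj_transpose_mat_1 [simp]: "conj_transpose (mat 1) = mat 1"
  by (auto simp add: vec_eq_iff conj_transpose_def mat_def)

lemma bounded_linear_conj_transpose: "bounded_linear (conj_transpose :: complex^'n::finite^'m::finite \<Rightarrow> _)"
  unfolding linear_conv_bounded_linear[symmetric]
  by (auto intro!: linearI simp: vec_eq_iff conj_transpose_def)

lemma scalar_product_eq_inner: "scalar_product Z W = Z \<bullet> W"
  by (simp add: scalar_product_def trace_def matrix_matrix_mult_def conj_transpose_def
      inner_vec_def inner_complex_def)

lemma inner_matrix_mult_left: 
  fixes A B Z :: "complex^'n::finite^'n"
  shows "(Z ** A) \<bullet> B = A \<bullet> (conj_transpose Z ** B)"
  unfolding scalar_product_eq_inner[symmetric] scalar_product_def conj_transpose_mult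
    conj_transpose_conj_transpose matrix_mul_assoc[symmetric]
  by (subst trace_mul_sym) (simp add: matrix_mul_assoc)

lemma inner_matrix_mult_right: 
  fixes A B Z :: "complex^'n::finite^'n"
  shows "(A ** Z) \<bullet> B = A \<bullet> (B ** conj_transpose Z)"
  unfolding scalar_product_eq_inner[symmetric] scalar_product_def conj_transpose_mult
    conj_transpose_conj_transpose matrix_mul_assoc[symmetric] ..

section \<open>Tangent spaces of a group of unitary matrices\<close>

locale unitary_subgroup =
  fixes G :: "(complex^'n::finite^'n) set"
  assumes unitary: "G \<subseteq> unitary_group"
    and one_closed: "mat 1 \<in> G"
    and mult_closed: "\<And>z w. z \<in> G \<Longrightarrow> w \<in> G \<Longrightarrow> z ** w \<in> G"
    and inv_closed: "\<And>z. z \<in> G \<Longrightarrow> conj_transpose z \<in> G"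
begin

abbreviation L where "L \<equiv> lie_algebra G"

lemma mult_conj_transpose: "z \<in> G \<Longrightarrow> z ** conj_transpose z = mat 1"
  using unitary by (auto simp: unitary_group_def)

lemma conj_transpose_mult_self: "z \<in> G \<Longrightarrow> conj_transpose z ** z = mat 1"
  using mult_conj_transpose matrix_left_right_inverse by blast

lemma cancel_left: "z \<in> G \<Longrightarrow> conj_transpose z ** (z ** A) = A"
  by (simp add: matrix_mul_assoc conj_transpose_mult_self)

lemma cancel_left': "z \<in> G \<Longrightarrow> z ** (conj_transpose z ** A) = A"
  by (simp add: matrix_mul_assoc mult_conj_transpose)

lemma matrix_inv_eq: 
  assumes "z \<in> G" shows "matrix_inv z = conj_transpose z"
proof -
  have "z ** matrix_inv z = mat 1 \<and> matrix_inv z ** z = mat 1"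
    unfolding matrix_inv_def
    by (rule someI[of _ "conj_transpose z"])
       (simp add: assms mult_conj_transpose conj_transpose_mult_self)
  then have "z ** matrix_inv z = mat 1" ..
  moreover have "conj_transpose z ** (z ** matrix_inv z) = matrix_inv z"
    using assms by (rule cancel_left)
  ultimately show ?thesis
    by simp
qed

lemma inner_translate:
  fixes A B :: "complex^'n^'n"
  shows "z \<in> G \<Longrightarrow> (z ** A) \<bullet> (z ** B) = A \<bullet> B"
  by (simp add: inner_matrix_mult_left cancel_left)

lemma metric_eq: "z \<in> G \<Longrightarrow> metric z V W = V \<bullet> W"
  using inner_translate[OF inv_closed]
  by (simp add: metric_def scalar_product_eq_inner matrix_inv_eq)

text \<open>Left translation carries curves in \<open>G\<close> to curves in \<open>G\<close>;
  translating by \<open>z\<close> and by its inverse \<open>conj_transpose z\<close> gives the two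
  inclusions.\<close>

lemma tangent_space_eq:
  assumes "z \<in> G" shows "tangent_space G z = (**) z ` L"
proof -
  have *: "w ** V \<in> tangent_space G (w ** v)" if w: "w \<in> G" and V: "V \<in> tangent_space G v" for v w V
  proof -
    obtain \<gamma> where \<gamma>: "\<And>t. \<gamma> t \<in> G" "\<gamma> 0 = v" "(\<gamma> has_vector_derivative V) (at (0::real))"
      using V by (auto simp: tangent_space_def)
    have "((\<lambda>t. w ** \<gamma> t) has_vector_derivative w ** V) (at 0)"
      by (rule bounded_linear.has_vector_derivative[OF matrix_mult.bounded_linear_right \<gamma>(3)])
    then show ?thesis
      using \<gamma>(1,2) mult_closed[OF w] unfolding tangent_space_def
      by (intro CollectI exI[of _ "\<lambda>t. w ** \<gamma> t"]) auto
  qed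
  show ?thesis
  proof
    show "(**) z ` L \<subseteq> tangent_space G z"
      using *[OF assms, of _ "mat 1"] by (auto simp: lie_algebra_def)
    show "tangent_space G z \<subseteq> (**) z ` L"
    proof
      fix V assume "V \<in> tangent_space G z"
      from *[OF inv_closed[OF assms] this] have "conj_transpose z ** V \<in> L"
        by (simp add: lie_algebra_def conj_transpose_mult_self assms)
      then show "V \<in> (**) z ` L"
        by (metis assms cancel_left' image_eqI)
    qed
  qed
qed

section \<open>The Lie algebra and its bracket\<close>

lemma lie_algebraE:
  assumes "A \<in> L"
  obtains \<gamma> :: "real \<Rightarrow> complex^'n^'n"
    where "\<And>t. \<gamma> t \<in> G" "\<gamma> 0 = mat 1" "(\<gamma> has_vector_derivative A) (at 0)"
  using assms by (auto simp: lie_algebra_def tangent_space_def)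

lemma lie_algebraI:
  assumes "\<And>t. \<gamma> t \<in> G" "\<gamma> 0 = mat 1" "(\<gamma> has_vector_derivative A) (at (0::real))"
  shows "A \<in> L"
  using assms by (auto simp: lie_algebra_def tangent_space_def)

text \<open>By the Leibniz rule the product of two curves through the identity has the sum of their
  velocities, and the reparametrisation \<open>c * t\<close> scales a velocity.\<close>

lemma subspace_lie_algebra: "subspace L"
proof (rule subspaceI)
  show "0 \<in> L"
    by (rule lie_algebraI[of "\<lambda>t. mat 1"]) (auto simp: one_closed)
next
  fix A B assume "A \<in> L" "B \<in> L"
  obtain \<gamma> where \<gamma>: "\<And>t. \<gamma> t \<in> G" "\<gamma> 0 = mat 1" "(\<gamma> has_vector_derivative A) (at (0::real))"
    using lie_algebraE[OF \<open>A \<in> L\<close>] by blast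
  obtain \<delta> where \<delta>: "\<And>t. \<delta> t \<in> G" "\<delta> 0 = mat 1" "(\<delta> has_vector_derivative B) (at (0::real))"
    using lie_algebraE[OF \<open>B \<in> L\<close>] by blast
  show "A + B \<in> L"
    using \<gamma> \<delta> matrix_mult.has_vector_derivative[OF \<gamma>(3) \<delta>(3)] mult_closed
    by (intro lie_algebraI[of "\<lambda>t. \<gamma> t ** \<delta> t"]) (auto simp: add.commute)
next
  fix A and c :: real assume "A \<in> L"
  then obtain \<gamma> where \<gamma>: "\<And>t. \<gamma> t \<in> G" "\<gamma> 0 = mat 1" "(\<gamma> has_vector_derivative A) (at (0::real))"
    using lie_algebraE by blast
  have "((\<lambda>t. \<gamma> (c * t)) has_vector_derivative c *\<^sub>R A) (at 0)"
    using vector_diff_chain_at[of "\<lambda>t. c * t" c 0 \<gamma> A] \<gamma>(3)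
      DERIV_cmult_Id[of c 0 UNIV, unfolded has_real_derivative_iff_has_vector_derivative]
    by (simp add: o_def)
  then show "c *\<^sub>R A \<in> L"
    using \<gamma> by (intro lie_algebraI[of "\<lambda>t. \<gamma> (c * t)"]) auto
qed

text \<open>Differentiate the constant \<open>\<gamma> t ** conj_transpose (\<gamma> t)\<close> at
  \<open>0\<close>.\<close>

lemma lie_algebra_skew:
  assumes "A \<in> L" shows "conj_transpose A = - A"
proof -
  obtain \<gamma> where \<gamma>: "\<And>t. \<gamma> t \<in> G" "\<gamma> 0 = mat 1" "(\<gamma> has_vector_derivative A) (at (0::real))"
    using lie_algebraE[OF assms] by blast
  have "((\<lambda>t. \<gamma> t ** conj_transpose (\<gamma> t)) has_vector_derivative conj_transpose A + A) (at 0)"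
    using matrix_mult.has_vector_derivative[OF \<gamma>(3)
        bounded_linear.has_vector_derivative[OF bounded_linear_conj_transpose \<gamma>(3)]]
    by (simp add: \<gamma>(2))
  moreover have "((\<lambda>t. \<gamma> t ** conj_transpose (\<gamma> t)) has_vector_derivative 0) (at 0)"
    using \<gamma>(1) by (simp add: mult_conj_transpose)
  ultimately show ?thesis
    using vector_derivative_unique_at eq_neg_iff_add_eq_0 by blast
qed

text \<open>Conjugating \<open>B\<close> by a curve with velocity \<open>A\<close> gives a curve
  inside \<open>L\<close> whose velocity at \<open>0\<close> is the commutator; being a subspace,
  \<open>L\<close> contains this velocity.\<close>

lemma lie_algebra_commutator:
  assumes "A \<in> L" "B \<in> L" shows "A ** B - B ** A \<in> L"
proof -
  obtain \<gamma> where \<gamma>: "\<And>t. \<gamma> t \<in> G" "\<gamma> 0 = mat 1" "(\<gamma> has_vector_derivative A) (at (0::real))"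
    using lie_algebraE[OF assms(1)] by blast
  have conj: "\<gamma> t ** B ** conj_transpose (\<gamma> t) \<in> L" for t
  proof -
    obtain \<delta> where \<delta>: "\<And>t. \<delta> t \<in> G" "\<delta> 0 = mat 1" "(\<delta> has_vector_derivative B) (at (0::real))"
      using lie_algebraE[OF assms(2)] by blast
    show ?thesis
      using \<delta> \<gamma>(1) mult_conj_transpose
      by (intro lie_algebraI[of "\<lambda>s. \<gamma> t ** \<delta> s ** conj_transpose (\<gamma> t)"] mult_closed inv_closed
          bounded_linear.has_vector_derivative[OF matrix_mult.bounded_linear_left]
          bounded_linear.has_vector_derivative[OF matrix_mult.bounded_linear_right]) auto
  qed
  have "((\<lambda>t. \<gamma> t ** B ** conj_transpose (\<gamma> t)) has_vector_derivative A ** B - B ** A) (at 0)"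
    using matrix_mult.has_vector_derivative[OF
        bounded_linear.has_vector_derivative[OF matrix_mult.bounded_linear_left[of B] \<gamma>(3)]
        bounded_linear.has_vector_derivative[OF bounded_linear_conj_transpose \<gamma>(3)]]
    by (simp add: \<gamma>(2) lie_algebra_skew[OF assms(1)] matrix_mult.minus_right)
  then show ?thesis
    using conj subspace_lie_algebra by (rule has_vector_derivative_in_subspace)
qed

text \<open>The infinitesimal form of bi-invariance: since \<open>A\<close> is skew-Hermitian, its
  adjoint action is skew for the scalar product.\<close>

lemma inner_commutator:
  assumes "A \<in> L"
  shows "(A ** X - X ** A) \<bullet> Y = - (X \<bullet> (A ** Y - Y ** A))"
  by (simp add: inner_diff_left inner_diff_right inner_matrix_mult_left[of A X]
      inner_matrix_mult_right[of X A] lie_algebra_skew[OF assms] matrix_mult.minus_left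
      matrix_mult.minus_right)

text \<open>\<open>frechet_derivative\<close> chooses one of possibly many derivatives within
  \<open>G\<close>. On \<open>z ** A\<close> they all agree, because each computes the velocity of
  \<open>f\<close> along a curve in \<open>G\<close>.\<close>

lemma differential_eq:
  assumes "(f has_derivative D) (at z within G)" "z \<in> G" "A \<in> L"
  shows "differential G f z (z ** A) = D (z ** A)"
proof -
  obtain \<gamma> where \<gamma>: "\<And>t. \<gamma> t \<in> G" "\<gamma> 0 = z" "(\<gamma> has_vector_derivative (z ** A)) (at (0::real))"
  proof -
    have "z ** A \<in> tangent_space G z"
      using assms(2,3) tangent_space_eq by blast
    then show ?thesis
      using that by (auto simp: tangent_space_def)
  qed
  have "(f has_derivative frechet_derivative f (at z within G)) (at z within G)"
    using assms(1) differentiableI frechet_derivative_works by blast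
  then have "frechet_derivative f (at z within G) (z ** A) = D (z ** A)"
    using has_vector_derivative_along_curve[of f _ \<gamma> G "z ** A"] assms(1) \<gamma>
    by (intro vector_derivative_unique_at[of "\<lambda>t. f (\<gamma> t)"]) simp_all
  then show ?thesis
    by (simp add: differential_def)
qed

end

section \<open>The Laplacian as a sum of second frame derivatives\<close>

lemma orthonormal_basis_pairwise:
  assumes "orthonormal_basis S B"
  shows "pairwise orthogonal B" "\<And>E. E \<in> B \<Longrightarrow> norm E = 1"
  using assms
  by (auto simp: orthonormal_basis_def scalar_product_eq_inner pairwise_def orthogonal_def norm_eq_1)

lemma orthonormal_basis_finite:
  assumes "orthonormal_basis S B" shows "finite B"
  using orthonormal_basis_pairwise[OF assms] pairwise_orthogonal_imp_finite by blast

lemma orthonormal_basis_expansion: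
  assumes "orthonormal_basis S B" "A \<in> S"
  shows "(\<Sum>E\<in>B. (A \<bullet> E) *\<^sub>R E) = A"
  using assms orthonormal_basis_pairwise[OF assms(1)] orthonormal_basis_finite[OF assms(1)]
  by (intro orthonormal_basis_expand) (auto simp: orthonormal_basis_def)

lemma ex_orthonormal_basis:
  assumes "subspace S"
  shows "\<exists>B. orthonormal_basis S B"
proof -
  obtain B where "B \<subseteq> S" "pairwise orthogonal B" "\<And>E. E \<in> B \<Longrightarrow> norm E = 1" "span B = S"
    using orthonormal_basis_subspace[OF assms] by metis
  then show ?thesis
    by (intro exI[of _ B])
       (auto simp: orthonormal_basis_def scalar_product_eq_inner pairwise_def orthogonal_def norm_eq_1)
qed

text \<open>\<open>F A\<close> is the derivative of \<open>f\<close> along the left-invariant field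
  of \<open>A\<close>. A relation with an explicit \<open>F\<close> avoids the choice hidden in
  \<open>differential\<close>, and iterating it gives second derivatives in closed form.\<close>

definition frame_derivative_on ::
  "(complex^'n::finite^'n) set \<Rightarrow> (complex^'n^'n) set \<Rightarrow> (complex^'n^'n \<Rightarrow> 'b::real_normed_vector) \<Rightarrow>
    (complex^'n^'n \<Rightarrow> complex^'n^'n \<Rightarrow> 'b) \<Rightarrow> bool"
  where "frame_derivative_on G W f F \<longleftrightarrow>
    (\<forall>z\<in>W. \<exists>D. (f has_derivative D) (at z within G) \<and> (\<forall>A\<in>lie_algebra G. D (z ** A) = F A z))"

lemma left_field_apply: "left_field A z = z ** A"
  by (simp add: left_field_def)

context unitary_subgroup
begin

lemma has_derivative_lincomb:
  assumes "(f has_derivative D) F" "orthonormal_basis L B" "A \<in> L"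
  shows "D (z ** A) = (\<Sum>E\<in>B. (A \<bullet> E) *\<^sub>R D (z ** E))"
proof -
  have "D (z ** A) = D (z ** (\<Sum>E\<in>B. (A \<bullet> E) *\<^sub>R E))"
    by (simp add: orthonormal_basis_expansion[OF assms(2,3)])
  then show ?thesis
    using has_derivative_linear[OF assms(1)]
    by (simp add: matrix_mult.sum_right matrix_mult.scaleR_right linear_sum linear_scale)
qed

text \<open>Left translation is an isometry, so this is Riesz representation on \<open>L\<close>,
  written in the basis \<open>B\<close>. Uniqueness comes from pairing the difference of two
  candidates with itself.\<close>

lemma gradient_eq:
  assumes D: "(f has_derivative D) (at z within G)" and B: "orthonormal_basis L B" and z: "z \<in> G"
  shows "gradient G f z = z ** (\<Sum>E\<in>B. D (z ** E) *\<^sub>R E)"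
proof -
  let ?S = "\<Sum>E\<in>B. D (z ** E) *\<^sub>R E"
  have S: "?S \<in> L"
    using B subspace_lie_algebra by (auto simp: orthonormal_basis_def intro!: subspace_sum subspace_scale)
  have S_inner: "?S \<bullet> A = D (z ** A)" if "A \<in> L" for A
    using has_derivative_lincomb[OF D B that]
    by (simp add: inner_sum_left inner_commute[of A] mult.commute)
  show ?thesis
    unfolding gradient_def
  proof (rule the_equality)
    show "z ** ?S \<in> tangent_space G z \<and>
        (\<forall>W\<in>tangent_space G z. metric z (z ** ?S) W = differential G f z W)"
      using S S_inner z D
      by (auto simp: tangent_space_eq metric_eq differential_eq inner_translate)
  next
    fix V assume V: "V \<in> tangent_space G z \<and> (\<forall>W\<in>tangent_space G z. metric z V W = differential G f z W)"
    then obtain A where A: "V = z ** A" "A \<in> L"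
      using z tangent_space_eq by blast
    have "A \<bullet> C = ?S \<bullet> C" if "C \<in> L" for C
      using V that z D S_inner by (auto simp: A tangent_space_eq metric_eq differential_eq inner_translate)
    from this[OF subspace_diff[OF subspace_lie_algebra A(2) S]] have "(A - ?S) \<bullet> (A - ?S) = 0"
      by (simp only: inner_diff_left diff_self)
    then show "V = z ** ?S"
      using A(1) by simp
  qed
qed

text \<open>\<open>\<eta>\<close> is \<open>Y\<close> expressed in the left-invariant frame. As for
  every bi-invariant metric, the connection is the derivative of these coefficients plus half the
  bracket.\<close>

lemma levi_civita_left_field:
  assumes A: "A \<in> L" and W: "openin (top_of_set G) W" and z: "z \<in> W"
    and Y: "\<And>w. w \<in> W \<Longrightarrow> Y w = w ** \<eta> w" and \<eta>: "\<And>w. w \<in> W \<Longrightarrow> \<eta> w \<in> L"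
    and \<eta>': "(\<eta> has_derivative \<eta>') (at z within G)" and \<eta>'_L: "\<And>C. C \<in> L \<Longrightarrow> \<eta>' (z ** C) \<in> L"
  shows "levi_civita G (left_field A) Y z = z ** (\<eta>' (z ** A) + (1/2) *\<^sub>R (A ** \<eta> z - \<eta> z ** A))"
proof -
  have zG: "z \<in> G" and WG: "W \<subseteq> G"
    using W z openin_subset by fastforce+
  note cong = has_derivative_cong_openin[OF _ W z]
  note eq = differential_eq[OF _ zG]
  let ?N = "\<eta>' (z ** A) + (1/2) *\<^sub>R (A ** \<eta> z - \<eta> z ** A)"
  have N: "?N \<in> L"
    using A z \<eta> \<eta>'_L lie_algebra_commutator subspace_lie_algebra
    by (intro subspace_add subspace_scale) auto
  have dY: "differential G Y z (z ** C) = z ** C ** \<eta> z + z ** \<eta>' (z ** C)" if "C \<in> L" for C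
  proof (rule eq[OF cong that])
    show "((\<lambda>w. w ** \<eta> w) has_derivative (\<lambda>V. V ** \<eta> z + z ** \<eta>' V)) (at z within G)"
      using matrix_mult.FDERIV[OF has_derivative_ident \<eta>'] by (simp add: add.commute)
  qed (simp add: Y)
  have dX: "differential G (left_field C) z (z ** B) = z ** B ** C" if "B \<in> L" for B C
    using eq[OF _ that, of "left_field C" "\<lambda>V. V ** C"]
    by (simp add: left_field_def[abs_def] bounded_linear_imp_has_derivative[OF matrix_mult.bounded_linear_left])
  have d1: "differential G (\<lambda>w. metric w (Y w) (left_field C w)) z (z ** B) = \<eta>' (z ** B) \<bullet> C"
    if "B \<in> L" for B C
  proof (rule eq[OF cong that])
    show "((\<lambda>w. \<eta> w \<bullet> C) has_derivative (\<lambda>V. \<eta>' V \<bullet> C)) (at z within G)"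
      by (intro has_derivative_inner_left \<eta>')
  qed (use WG in \<open>auto simp: Y metric_eq left_field_apply inner_translate\<close>)
  have d2: "differential G (\<lambda>w. metric w (left_field A w) (left_field C w)) z (z ** B) = 0"
    if "B \<in> L" for B C
  proof (rule eq[OF cong that, where D="\<lambda>_. 0"])
    show "((\<lambda>w. A \<bullet> C) has_derivative (\<lambda>_. 0)) (at z within G)"
      by simp
  qed (use WG in \<open>auto simp: metric_eq left_field_apply inner_translate\<close>)
  have d3: "differential G (\<lambda>w. metric w (left_field A w) (Y w)) z (z ** B) = A \<bullet> \<eta>' (z ** B)"
    if "B \<in> L" for B
  proof (rule eq[OF cong that])
    show "((\<lambda>w. A \<bullet> \<eta> w) has_derivative (\<lambda>V. A \<bullet> \<eta>' V)) (at z within G)"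
      by (intro has_derivative_inner_right \<eta>')
  qed (use WG in \<open>auto simp: Y metric_eq left_field_apply inner_translate\<close>)
  have Lz: "\<eta> z \<in> L"
    using \<eta> z .
  have b1: "bracket G (left_field A) Y z = z ** (A ** \<eta> z - \<eta> z ** A + \<eta>' (z ** A))"
    using A Lz by (simp add: bracket_def Y z dX dY dX left_field_apply matrix_mult.add_right
        matrix_mult.diff_right matrix_mul_assoc)
  have b2: "bracket G (left_field A) (left_field C) z = z ** (A ** C - C ** A)" if "C \<in> L" for C
    using A that by (simp add: bracket_def dX left_field_apply matrix_mult.diff_right matrix_mul_assoc)
  have b3: "bracket G Y (left_field C) z = z ** (\<eta> z ** C - C ** \<eta> z - \<eta>' (z ** C))" if "C \<in> L" for C
    using that Lz by (simp add: bracket_def Y z dX dY dX left_field_apply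
        matrix_mult.diff_right matrix_mul_assoc)
  let ?K = "\<lambda>C. differential G (\<lambda>w. metric w (Y w) (left_field C w)) z (left_field A z)
            + differential G (\<lambda>w. metric w (left_field A w) (left_field C w)) z (Y z)
            - differential G (\<lambda>w. metric w (left_field A w) (Y w)) z (left_field C z)
            + metric z (bracket G (left_field A) Y z) (left_field C z)
            - metric z (bracket G (left_field A) (left_field C) z) (Y z)
            - metric z (bracket G Y (left_field C) z) (left_field A z)"
  have koszul: "?K C = 2 * (?N \<bullet> C)" if C: "C \<in> L" for C
  proof -
    have "?K C = \<eta>' (z ** A) \<bullet> C + 0 - A \<bullet> \<eta>' (z ** C)
        + (A ** \<eta> z - \<eta> z ** A + \<eta>' (z ** A)) \<bullet> C
        - (A ** C - C ** A) \<bullet> \<eta> z - (\<eta> z ** C - C ** \<eta> z - \<eta>' (z ** C)) \<bullet> A"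
      using A C Lz zG by (simp only: b1 b2 b3 left_field_apply[of _ z] Y[OF z] d1 d2 d3 metric_eq inner_translate)
    \<comment> \<open>By skewness of the adjoint action the brackets containing \<open>C\<close>
      turn into the bracket of \<open>A\<close> and \<open>\<eta> z\<close> paired with
      \<open>C\<close>. The six Koszul terms then collapse to twice the pairing with
      \<open>?N\<close>.\<close>
    moreover have "(A ** C - C ** A) \<bullet> \<eta> z = - ((A ** \<eta> z - \<eta> z ** A) \<bullet> C)"
      using inner_commutator[OF A, of C "\<eta> z"] by (simp only: inner_commute[of C])
    moreover have "(\<eta> z ** C - C ** \<eta> z) \<bullet> A = (A ** \<eta> z - \<eta> z ** A) \<bullet> C"
      using inner_commutator[OF Lz, of C A] inner_commute[of C "A ** \<eta> z - \<eta> z ** A"]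
      by (simp add: inner_diff_right)
    ultimately show ?thesis
      by (simp add: inner_add_left inner_diff_left inner_commute algebra_simps)
  qed
  show ?thesis
    unfolding levi_civita_def
  proof (rule the_equality)
    show "z ** ?N \<in> tangent_space G z \<and> (\<forall>X\<in>left_field ` L. 2 * metric z (z ** ?N) (X z) =
              differential G (\<lambda>w. metric w (Y w) (X w)) z (left_field A z)
            + differential G (\<lambda>w. metric w (left_field A w) (X w)) z (Y z)
            - differential G (\<lambda>w. metric w (left_field A w) (Y w)) z (X z)
            + metric z (bracket G (left_field A) Y z) (X z)
            - metric z (bracket G (left_field A) X z) (Y z)
            - metric z (bracket G Y X z) (left_field A z))"
      using N zG koszul
      by (auto simp: tangent_space_eq metric_eq inner_translate left_field_apply simp del: inner_add_left)
  next
    fix V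
    assume V: "V \<in> tangent_space G z \<and> (\<forall>X\<in>left_field ` L. 2 * metric z V (X z) =
              differential G (\<lambda>w. metric w (Y w) (X w)) z (left_field A z)
            + differential G (\<lambda>w. metric w (left_field A w) (X w)) z (Y z)
            - differential G (\<lambda>w. metric w (left_field A w) (Y w)) z (X z)
            + metric z (bracket G (left_field A) Y z) (X z)
            - metric z (bracket G (left_field A) X z) (Y z)
            - metric z (bracket G Y X z) (left_field A z))"
    then obtain M where M: "V = z ** M" "M \<in> L"
      using zG tangent_space_eq by blast
    have "M \<bullet> C = ?N \<bullet> C" if "C \<in> L" for C
    proof -
      have "2 * metric z V (left_field C z) = ?K C"
        using V that by blast
      also have "\<dots> = 2 * (?N \<bullet> C)"
        using koszul that .
      finally show ?thesis
        using zG by (simp add: M metric_eq left_field_apply inner_translate)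
    qed
    from this[OF subspace_diff[OF subspace_lie_algebra M(2) N]] have "(M - ?N) \<bullet> (M - ?N) = 0"
      by (simp only: inner_diff_left diff_self)
    then show "V = z ** ?N"
      using M(1) by simp
  qed
qed

text \<open>The gradient has the coefficients \<open>F E\<close> in the frame. In the trace, the
  half bracket of \<open>C\<close> and \<open>\<eta> z\<close> is orthogonal to \<open>C\<close>, so
  only derivatives of the coefficients remain.\<close>

lemma laplace_beltrami_real_eq:
  assumes B: "orthonormal_basis L B" and W: "openin (top_of_set G) W" and z: "z \<in> W"
    and f: "frame_derivative_on G W f F"
    and F: "\<And>A. A \<in> L \<Longrightarrow> frame_derivative_on G W (F A) (F2 A)"
  shows "laplace_beltrami_real G f z = (\<Sum>E\<in>B. F2 E E z)"
proof -
  have BL: "B \<subseteq> L"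
    using B by (simp add: orthonormal_basis_def)
  have WG: "W \<subseteq> G"
    using W openin_subset by fastforce
  define \<eta> where "\<eta> w = (\<Sum>E\<in>B. F E w *\<^sub>R E)" for w
  have \<eta>: "\<eta> w \<in> L" for w
    unfolding \<eta>_def using BL subspace_lie_algebra by (auto intro!: subspace_sum subspace_scale)
  have Y: "gradient G f w = w ** \<eta> w" if w: "w \<in> W" for w
  proof -
    obtain D where D: "(f has_derivative D) (at w within G)" "\<And>A. A \<in> L \<Longrightarrow> D (w ** A) = F A w"
      using f w by (auto simp: frame_derivative_on_def)
    show ?thesis
      using gradient_eq[OF D(1) B] w WG D(2) BL by (auto simp: \<eta>_def subset_iff intro!: arg_cong2[where f="(**)"] sum.cong)
  qed
  have "\<forall>E\<in>B. \<exists>D. (F E has_derivative D) (at z within G) \<and> (\<forall>A\<in>L. D (z ** A) = F2 E A z)"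
    using F BL z by (auto simp: frame_derivative_on_def)
  then obtain D where D: "\<And>E. E \<in> B \<Longrightarrow> (F E has_derivative D E) (at z within G)"
    and D_eq: "\<And>E A. E \<in> B \<Longrightarrow> A \<in> L \<Longrightarrow> D E (z ** A) = F2 E A z"
    by metis
  define \<eta>' where "\<eta>' V = (\<Sum>E\<in>B. D E V *\<^sub>R E)" for V
  have \<eta>'_L: "\<eta>' V \<in> L" for V
    unfolding \<eta>'_def using BL subspace_lie_algebra by (auto intro!: subspace_sum subspace_scale)
  have \<eta>': "(\<eta> has_derivative \<eta>') (at z within G)"
    unfolding \<eta>_def[abs_def] \<eta>'_def[abs_def]
    by (intro has_derivative_sum has_derivative_scaleR_left D)
  \<comment> \<open>The basis inside \<open>divergence\<close> is an arbitrary choice and may differ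
    from \<open>B\<close>.\<close>
  define B' where "B' = (SOME B. orthonormal_basis L B)"
  have B': "orthonormal_basis L B'"
    unfolding B'_def using ex_orthonormal_basis[OF subspace_lie_algebra] by (rule someI_ex)
  then have B'L: "B' \<subseteq> L"
    by (simp add: orthonormal_basis_def)
  have "laplace_beltrami_real G f z = (\<Sum>C\<in>B'. metric z (levi_civita G (left_field C) (gradient G f) z) (left_field C z))"
    by (simp add: laplace_beltrami_real_def divergence_def B'_def)
  also have "\<dots> = (\<Sum>C\<in>B'. \<eta>' (z ** C) \<bullet> C)"
  proof (rule sum.cong[OF refl])
    fix C assume "C \<in> B'"
    then have C: "C \<in> L"
      using B'L by blast
    have "(C ** \<eta> z - \<eta> z ** C) \<bullet> C = 0"
      using inner_commutator[OF C, of "\<eta> z" C] by simp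
    then show "metric z (levi_civita G (left_field C) (gradient G f) z) (left_field C z) = \<eta>' (z ** C) \<bullet> C"
      using z WG levi_civita_left_field[OF C W z Y \<eta> \<eta>' \<eta>'_L]
      by (auto simp: metric_eq left_field_apply inner_translate inner_add_left)
  qed
  also have "\<dots> = (\<Sum>C\<in>B'. \<Sum>E\<in>B. (E \<bullet> C) * D E (z ** C))"
    by (simp add: \<eta>'_def inner_sum_left mult.commute)
  also have "\<dots> = (\<Sum>E\<in>B. \<Sum>C\<in>B'. (E \<bullet> C) * D E (z ** C))"
    by (rule sum.swap)
  also have "\<dots> = (\<Sum>E\<in>B. F2 E E z)"
  proof (rule sum.cong[OF refl])
    \<comment> \<open>For fixed \<open>E\<close> the sum over \<open>B'\<close> expands
      \<open>E\<close> in \<open>B'\<close>, which gives the derivative along \<open>E\<close>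
      itself.\<close>
    fix E assume "E \<in> B"
    then show "(\<Sum>C\<in>B'. (E \<bullet> C) * D E (z ** C)) = F2 E E z"
      using has_derivative_lincomb[OF D B', of E E z] BL D_eq by (auto simp: subset_iff)
  qed
  finally show ?thesis .
qed

lemma frame_derivative_on_bounded_linear:
  assumes "bounded_linear h" "frame_derivative_on G W f F"
  shows "frame_derivative_on G W (\<lambda>z. h (f z)) (\<lambda>A z. h (F A z))"
  using assms(2) bounded_linear.has_derivative[OF assms(1)] unfolding frame_derivative_on_def by metis

lemma laplace_beltrami_eq:
  assumes B: "orthonormal_basis L B" and W: "openin (top_of_set G) W" and z: "z \<in> W"
    and f: "frame_derivative_on G W f F"
    and F: "\<And>A. A \<in> L \<Longrightarrow> frame_derivative_on G W (F A) (F2 A)"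
  shows "laplace_beltrami G f z = (\<Sum>E\<in>B. F2 E E z)"
  using laplace_beltrami_real_eq[OF B W z frame_derivative_on_bounded_linear[OF bounded_linear_Re f]
      frame_derivative_on_bounded_linear[OF bounded_linear_Re F]]
    laplace_beltrami_real_eq[OF B W z frame_derivative_on_bounded_linear[OF bounded_linear_Im f]
      frame_derivative_on_bounded_linear[OF bounded_linear_Im F]]
  by (simp add: laplace_beltrami_def complex_eq_iff)

end

section \<open>Functions of a quotient of column sums\<close>

lemma frame_derivative_on_cong:
  assumes "frame_derivative_on G W f F" and "openin (top_of_set G) W"
    and "\<And>z. z \<in> W \<Longrightarrow> f z = g z"
    and "\<And>A z. A \<in> lie_algebra G \<Longrightarrow> z \<in> W \<Longrightarrow> F A z = F' A z"
  shows "frame_derivative_on G W g F'"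
  unfolding frame_derivative_on_def
proof
  fix z assume "z \<in> W"
  then obtain D where "(f has_derivative D) (at z within G)" "\<forall>A\<in>lie_algebra G. D (z ** A) = F A z"
    using assms(1) by (auto simp: frame_derivative_on_def)
  then show "\<exists>D. (g has_derivative D) (at z within G) \<and> (\<forall>A\<in>lie_algebra G. D (z ** A) = F' A z)"
    using has_derivative_cong_openin[OF _ assms(2) \<open>z \<in> W\<close>] assms(3,4) \<open>z \<in> W\<close>
    by (intro exI[of _ D]) auto
qed

lemma frame_derivative_on_const: "frame_derivative_on G W (\<lambda>z. c) (\<lambda>A z. 0)"
  by (auto simp: frame_derivative_on_def intro!: exI[of _ "\<lambda>_. 0"])

lemma frame_derivative_on_entry:
  "frame_derivative_on G W (\<lambda>z :: complex^'n::finite^'n. z $ i $ j) (\<lambda>A z. (z ** A) $ i $ j)"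
proof -
  have "((\<lambda>z. z $ i $ j) has_derivative (\<lambda>V. V $ i $ j)) F" for F :: "(complex^'n^'n) filter"
    by (rule bounded_linear_imp_has_derivative)
       (rule bounded_linear_compose[OF bounded_linear_vec_nth bounded_linear_vec_nth])
  then show ?thesis
    unfolding frame_derivative_on_def by blast
qed

lemma frame_derivative_on_add:
  assumes "frame_derivative_on G W f F" "frame_derivative_on G W g H"
  shows "frame_derivative_on G W (\<lambda>z. f z + g z) (\<lambda>A z. F A z + H A z)"
  unfolding frame_derivative_on_def
proof
  fix z assume z: "z \<in> W"
  obtain D where D: "(f has_derivative D) (at z within G)" "\<forall>A\<in>lie_algebra G. D (z ** A) = F A z"
    using assms(1) z by (auto simp: frame_derivative_on_def)
  obtain E where E: "(g has_derivative E) (at z within G)" "\<forall>A\<in>lie_algebra G. E (z ** A) = H A z"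
    using assms(2) z by (auto simp: frame_derivative_on_def)
  show "\<exists>D. ((\<lambda>z. f z + g z) has_derivative D) (at z within G) \<and>
      (\<forall>A\<in>lie_algebra G. D (z ** A) = F A z + H A z)"
    using has_derivative_add[OF D(1) E(1)] D(2) E(2) by auto
qed

lemma frame_derivative_on_mult:
  fixes f g :: "complex^'n::finite^'n \<Rightarrow> complex"
  assumes "frame_derivative_on G W f F" "frame_derivative_on G W g H"
  shows "frame_derivative_on G W (\<lambda>z. f z * g z) (\<lambda>A z. f z * H A z + F A z * g z)"
  unfolding frame_derivative_on_def
proof
  fix z assume z: "z \<in> W"
  obtain D where D: "(f has_derivative D) (at z within G)" "\<forall>A\<in>lie_algebra G. D (z ** A) = F A z"
    using assms(1) z by (auto simp: frame_derivative_on_def)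
  obtain E where E: "(g has_derivative E) (at z within G)" "\<forall>A\<in>lie_algebra G. E (z ** A) = H A z"
    using assms(2) z by (auto simp: frame_derivative_on_def)
  show "\<exists>D. ((\<lambda>z. f z * g z) has_derivative D) (at z within G) \<and>
      (\<forall>A\<in>lie_algebra G. D (z ** A) = f z * H A z + F A z * g z)"
    using has_derivative_mult[OF D(1) E(1)] D(2) E(2) by auto
qed

lemma frame_derivative_on_divide:
  fixes f g :: "complex^'n::finite^'n \<Rightarrow> complex"
  assumes "frame_derivative_on G W f F" "frame_derivative_on G W g H" "\<And>z. z \<in> W \<Longrightarrow> g z \<noteq> 0"
  shows "frame_derivative_on G W (\<lambda>z. f z / g z) (\<lambda>A z. (F A z * g z - f z * H A z) / (g z * g z))"
  unfolding frame_derivative_on_def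
proof
  fix z assume z: "z \<in> W"
  obtain D where D: "(f has_derivative D) (at z within G)" "\<forall>A\<in>lie_algebra G. D (z ** A) = F A z"
    using assms(1) z by (auto simp: frame_derivative_on_def)
  obtain E where E: "(g has_derivative E) (at z within G)" "\<forall>A\<in>lie_algebra G. E (z ** A) = H A z"
    using assms(2) z by (auto simp: frame_derivative_on_def)
  show "\<exists>D. ((\<lambda>z. f z / g z) has_derivative D) (at z within G) \<and>
      (\<forall>A\<in>lie_algebra G. D (z ** A) = (F A z * g z - f z * H A z) / (g z * g z))"
    using has_derivative_divide'[OF D(1) E(1) assms(3)[OF z]] D(2) E(2) by auto
qed

lemma frame_derivative_on_poly:
  fixes f :: "complex^'n::finite^'n \<Rightarrow> complex"
  assumes "frame_derivative_on G W f F"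
  shows "frame_derivative_on G W (\<lambda>z. poly p (f z)) (\<lambda>A z. poly (pderiv p) (f z) * F A z)"
  unfolding frame_derivative_on_def
proof
  fix z assume z: "z \<in> W"
  obtain D where D: "(f has_derivative D) (at z within G)" "\<forall>A\<in>lie_algebra G. D (z ** A) = F A z"
    using assms(1) z by (auto simp: frame_derivative_on_def)
  show "\<exists>D. ((\<lambda>z. poly p (f z)) has_derivative D) (at z within G) \<and>
      (\<forall>A\<in>lie_algebra G. D (z ** A) = poly (pderiv p) (f z) * F A z)"
    using has_derivative_compose[OF D(1) poly_DERIV[unfolded has_field_derivative_def]] D(2)
    by (intro exI[of _ "\<lambda>V. poly (pderiv p) (f z) * D V"]) auto
qed

section \<open>Smoothness of algebras closed under left-invariant fields\<close>

lemma Ck_on_cong: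
  assumes W: "openin (top_of_set G) W"
  shows "Ck_on k G W f \<Longrightarrow> (\<And>z. z \<in> W \<Longrightarrow> f z = g z) \<Longrightarrow> Ck_on k G W g"
proof (induction k arbitrary: f g)
  case 0
  then show ?case
    using continuous_on_cong by fastforce
next
  case (Suc k)
  \<comment> \<open>At points of \<open>W\<close> both functions have the same derivatives, so
    \<open>frechet_derivative\<close> makes the same choice for both, even on vectors that are not
    tangent.\<close>
  have iff: "(f has_derivative D) (at z within G) \<longleftrightarrow> (g has_derivative D) (at z within G)"
    if "z \<in> W" for D z
    using has_derivative_cong_openin[OF _ W that] Suc.prems(2) by metis
  then have "differential G f z V = differential G g z V" if "z \<in> W" for z V
    using that by (simp add: differential_def frechet_derivative_def)
  then have "Ck_on k G W (\<lambda>z. differential G g z (left_field Z z))" if "Z \<in> lie_algebra G" for Z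
    using Suc.prems(1) that by - (rule Suc.IH[of "\<lambda>z. differential G f z (left_field Z z)"]; simp)
  then show ?case
    using Suc.prems(1) iff by (auto simp: differentiable_def)
qed

text \<open>The complex algebra generated by \<open>X\<close>. Once it is closed under
  left-invariant derivatives, all its members are smooth.\<close>

inductive_set function_algebra :: "('a \<Rightarrow> complex) set \<Rightarrow> ('a \<Rightarrow> complex) set" for X where
  generator: "f \<in> X \<Longrightarrow> f \<in> function_algebra X"
| const: "(\<lambda>_. c) \<in> function_algebra X"
| add: "f \<in> function_algebra X \<Longrightarrow> g \<in> function_algebra X \<Longrightarrow> (\<lambda>z. f z + g z) \<in> function_algebra X"
| mult: "f \<in> function_algebra X \<Longrightarrow> g \<in> function_algebra X \<Longrightarrow> (\<lambda>z. f z * g z) \<in> function_algebra X"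

lemma function_algebra_poly:
  assumes "f \<in> function_algebra X"
  shows "(\<lambda>z. poly p (f z)) \<in> function_algebra X"
proof (induction p)
  case (pCons a p)
  then show ?case
    using function_algebra.add[OF function_algebra.const function_algebra.mult[OF assms pCons.IH]]
    by simp
qed (simp add: function_algebra.const)

text \<open>The sum and Leibniz rules propagate the property from the generators.\<close>

lemma function_algebra_frame_derivative:
  assumes "\<And>f. f \<in> X \<Longrightarrow> \<exists>F. frame_derivative_on G W f F \<and> (\<forall>A\<in>lie_algebra G. F A \<in> function_algebra X)"
    and "f \<in> function_algebra X"
  shows "\<exists>F. frame_derivative_on G W f F \<and> (\<forall>A\<in>lie_algebra G. F A \<in> function_algebra X)"
  using assms(2)
proof induction
  case (const c)
  show ?case
    using frame_derivative_on_const function_algebra.const by blast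
next
  case (add f g)
  then obtain F H where FH: "frame_derivative_on G W f F" "\<forall>A\<in>lie_algebra G. F A \<in> function_algebra X"
    "frame_derivative_on G W g H" "\<forall>A\<in>lie_algebra G. H A \<in> function_algebra X"
    by blast
  show ?case
    using FH frame_derivative_on_add[OF FH(1,3)]
    by (intro exI[of _ "\<lambda>A z. F A z + H A z"]) (simp add: function_algebra.add)
next
  case (mult f g)
  then obtain F H where FH: "frame_derivative_on G W f F" "\<forall>A\<in>lie_algebra G. F A \<in> function_algebra X"
    "frame_derivative_on G W g H" "\<forall>A\<in>lie_algebra G. H A \<in> function_algebra X"
    by blast
  show ?case
    using mult.hyps FH frame_derivative_on_mult[OF FH(1,3)]
    by (intro exI[of _ "\<lambda>A z. f z * H A z + F A z * g z"])
       (simp add: function_algebra.add function_algebra.mult)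
qed (use assms(1) in blast)

context unitary_subgroup
begin

text \<open>Induction on \<open>k\<close>: every derivative along a left-invariant field lies in
  \<open>S\<close> again.\<close>

lemma Ck_on_invariant_set:
  assumes W: "openin (top_of_set G) W"
    and S: "\<And>f. f \<in> S \<Longrightarrow> \<exists>F. frame_derivative_on G W f F \<and> (\<forall>A\<in>L. F A \<in> S)"
  shows "f \<in> S \<Longrightarrow> Ck_on k G W f"
proof (induction k arbitrary: f)
  have WG: "W \<subseteq> G"
    using W openin_subset by fastforce
  have diff: "f differentiable at z within G" if "f \<in> S" "z \<in> W" for f z
    using S[OF that(1)] that(2) by (auto simp: frame_derivative_on_def differentiable_def)
  {
    case 0
    then have "continuous (at z within W) f" if "z \<in> W" for z
      using diff[OF 0 that] WG continuous_within_subset differentiable_imp_continuous_within by blast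
    then show ?case
      by (simp add: continuous_on_eq_continuous_within)
  next
    case (Suc k)
    obtain F where F: "frame_derivative_on G W f F" "\<forall>A\<in>L. F A \<in> S"
      using S[OF Suc.prems] by blast
    have "differential G f z (left_field A z) = F A z" if A: "A \<in> L" and z: "z \<in> W" for A z
    proof -
      obtain D where "(f has_derivative D) (at z within G)" "\<forall>A\<in>L. D (z ** A) = F A z"
        using F(1) z by (auto simp: frame_derivative_on_def)
      then show ?thesis
        using A z WG differential_eq[of f D z A] by (auto simp: left_field_apply)
    qed
    then have "Ck_on k G W (\<lambda>z. differential G f z (left_field A z))" if "A \<in> L" for A
      using Suc.IH[of "F A"] F(2) that by - (rule Ck_on_cong[OF W, of k "F A"]; simp)
    then show ?case
      using diff[OF Suc.prems] by simp
  }
qed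

end

text \<open>Column \<open>j\<close> supplies the denominator; keeping \<open>j\<close> and
  \<open>k\<close> variable treats both orders of the columns at once. The identities in
  \<open>B_sums\<close> are what the Laplacian sees of the frame, so U(2) and SU(2) share the
  computation.\<close>

locale column_chart = unitary_subgroup G for G :: "(complex^2^2) set" +
  fixes W B :: "(complex^2^2) set" and j k :: 2 and t :: complex
  assumes W: "openin (top_of_set G) W"
    and jk: "j \<noteq> k"
    and nonzero: "\<And>z. z \<in> W \<Longrightarrow> t * z $ 1 $ j + z $ 2 $ j \<noteq> 0"
    and B: "orthonormal_basis (lie_algebra G) B"
    and B_sums: "(\<Sum>E\<in>B. E $ j $ k * E $ k $ j) = -1" "(\<Sum>E\<in>B. (E $ k $ k - E $ j $ j)^2) = -2"
      "(\<Sum>E\<in>B. (E $ j $ k)^2) = 0" "(\<Sum>E\<in>B. (E $ k $ j)^2) = 0"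
      "(\<Sum>E\<in>B. E $ j $ k * (E $ k $ k - E $ j $ j)) = 0"
      "(\<Sum>E\<in>B. E $ k $ j * (E $ k $ k - E $ j $ j)) = 0"
begin

section \<open>Chart functions and their frame derivatives\<close>

definition "x z = t * z $ 1 $ j + z $ 2 $ j" for z :: "complex^2^2"
definition "y z = t * z $ 1 $ k + z $ 2 $ k" for z :: "complex^2^2"
definition "w z = y z / x z"
definition "g z = z $ 1 $ j / x z"
text \<open>This is \<open>det z / (x z)^2\<close>, with a minus sign if
  \<open>j = 2\<close>.\<close>

definition "d z = w z * g z - z $ 1 $ k / x z"
text \<open>A Riccati field: one-parameter groups acting from the right move the ratio
  \<open>w\<close> of the column sums by Moebius transformations, with this quadratic as
  velocity.\<close>

definition "\<phi> A z = A $ j $ k + w z * (A $ k $ k - A $ j $ j) - (w z)^2 * A $ k $ j" for A :: "complex^2^2"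
text \<open>The derivative of the quadratic \<open>\<phi> A\<close> with respect to
  \<open>w\<close>; it is also the logarithmic derivative of \<open>d\<close> along
  \<open>A\<close>.\<close>

definition "\<psi> A z = A $ k $ k - A $ j $ j - 2 * w z * A $ k $ j" for A :: "complex^2^2"

lemma entry_mult:
  "(z ** A) $ i $ l = z $ i $ j * A $ j $ l + z $ i $ k * A $ k $ l" for z A :: "complex^2^2"
  using jk exhaust_2[of j] exhaust_2[of k] by (auto simp: matrix_matrix_mult_def sum_2)

lemma x_nonzero: "z \<in> W \<Longrightarrow> x z \<noteq> 0"
  using nonzero by (simp add: x_def)

lemma frame_derivative_x:
  "frame_derivative_on G W x (\<lambda>A z. x z * A $ j $ j + y z * A $ k $ j)"
  unfolding x_def[abs_def]
  by (rule frame_derivative_on_cong[OF frame_derivative_on_add[OF frame_derivative_on_mult[OF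
        frame_derivative_on_const frame_derivative_on_entry] frame_derivative_on_entry] W])
     (auto simp: entry_mult y_def algebra_simps)

lemma frame_derivative_y:
  "frame_derivative_on G W y (\<lambda>A z. x z * A $ j $ k + y z * A $ k $ k)"
  unfolding y_def[abs_def]
  by (rule frame_derivative_on_cong[OF frame_derivative_on_add[OF frame_derivative_on_mult[OF
        frame_derivative_on_const frame_derivative_on_entry] frame_derivative_on_entry] W])
     (auto simp: entry_mult x_def algebra_simps)

lemma frame_derivative_w: "frame_derivative_on G W w \<phi>"
  unfolding w_def[abs_def]
  by (rule frame_derivative_on_cong[OF frame_derivative_on_divide[OF
        frame_derivative_y frame_derivative_x x_nonzero] W])
     (auto simp: \<phi>_def w_def x_nonzero field_simps power2_eq_square)

lemma frame_derivative_g: "frame_derivative_on G W g (\<lambda>A z. - d z * A $ k $ j)"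
  unfolding g_def[abs_def]
  by (rule frame_derivative_on_cong[OF frame_derivative_on_divide[OF
        frame_derivative_on_entry[of G W 1 j] frame_derivative_x x_nonzero] W])
     (auto simp: d_def w_def g_def entry_mult x_nonzero field_simps)

lemma frame_derivative_d: "frame_derivative_on G W d (\<lambda>A z. d z * \<psi> A z)"
proof -
  have "frame_derivative_on G W (\<lambda>z. w z * g z + (- 1) * (z $ 1 $ k / x z)) (\<lambda>A z. d z * \<psi> A z)"
    by (rule frame_derivative_on_cong[OF frame_derivative_on_add[OF frame_derivative_on_mult[OF
        frame_derivative_w frame_derivative_g] frame_derivative_on_mult[OF
        frame_derivative_on_const[of G W "- 1"] frame_derivative_on_divide[OF frame_derivative_on_entry[of G W 1 k] frame_derivative_x x_nonzero]]] W])
       (auto simp: \<phi>_def \<psi>_def d_def w_def g_def entry_mult x_nonzero field_simps power2_eq_square)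
  then show ?thesis
    by (simp add: d_def[abs_def])
qed

lemma frame_derivative_\<phi>: "frame_derivative_on G W (\<phi> A) (\<lambda>C z. \<psi> A z * \<phi> C z)"
proof -
  let ?p = "[:A $ j $ k, A $ k $ k - A $ j $ j, - A $ k $ j:]"
  show ?thesis
    by (rule frame_derivative_on_cong[OF frame_derivative_on_poly[OF frame_derivative_w, of ?p] W])
       (auto simp: \<phi>_def \<psi>_def pderiv_pCons algebra_simps power2_eq_square)
qed

lemma frame_derivative_\<psi>: "frame_derivative_on G W (\<psi> A) (\<lambda>C z. - 2 * A $ k $ j * \<phi> C z)"
proof -
  let ?p = "[:A $ k $ k - A $ j $ j, - 2 * A $ k $ j:]"
  show ?thesis
    by (rule frame_derivative_on_cong[OF frame_derivative_on_poly[OF frame_derivative_w, of ?p] W])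
       (auto simp: \<phi>_def \<psi>_def pderiv_pCons algebra_simps)
qed

section \<open>Smoothness of polynomial expressions in the chart functions\<close>

lemma \<phi>_in_algebra: "\<phi> A \<in> function_algebra {w, g, d}"
proof -
  have "\<phi> A = (\<lambda>z. poly [:A $ j $ k, A $ k $ k - A $ j $ j, - A $ k $ j:] (w z))"
    by (auto simp: \<phi>_def fun_eq_iff algebra_simps power2_eq_square)
  then show ?thesis
    by (simp only:) (intro function_algebra_poly function_algebra.generator insertI1)
qed

lemma \<psi>_in_algebra: "\<psi> A \<in> function_algebra {w, g, d}"
proof -
  have "\<psi> A = (\<lambda>z. poly [:A $ k $ k - A $ j $ j, - 2 * A $ k $ j:] (w z))"
    by (auto simp: \<psi>_def fun_eq_iff algebra_simps)
  then show ?thesis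
    by (simp only:) (intro function_algebra_poly function_algebra.generator insertI1)
qed

lemma smooth_on_algebra:
  assumes "f \<in> function_algebra {w, g, d}"
  shows "smooth_on G W f"
proof -
  have neg_d: "(\<lambda>z. - d z * c) \<in> function_algebra {w, g, d}" for c
  proof -
    have "(\<lambda>z. d z * (- c)) \<in> function_algebra {w, g, d}"
      by (intro function_algebra.mult function_algebra.const function_algebra.generator) simp
    then show ?thesis
      by simp
  qed
  have "\<exists>F. frame_derivative_on G W h F \<and> (\<forall>A\<in>L. F A \<in> function_algebra {w, g, d})"
    if "h \<in> {w, g, d}" for h
    using that frame_derivative_w frame_derivative_g frame_derivative_d \<phi>_in_algebra neg_d
      function_algebra.mult[OF function_algebra.generator[of d] \<psi>_in_algebra]
    by blast
  from function_algebra_frame_derivative[OF this] show ?thesis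
    unfolding smooth_on_def using Ck_on_invariant_set[OF W] assms by blast
qed

text \<open>The gradient of \<open>w\<close> is isotropic for the complex-bilinear metric: diagonal
  and off-diagonal contributions cancel.\<close>

lemma sum_\<phi>_\<phi>: "(\<Sum>E\<in>B. (\<phi> E z)^2) = 0"
proof -
  have "(\<phi> E z)^2 = (E $ j $ k)^2 + (w z)^2 * (E $ k $ k - E $ j $ j)^2 + (w z)^4 * (E $ k $ j)^2
      + 2 * w z * (E $ j $ k * (E $ k $ k - E $ j $ j)) - 2 * (w z)^2 * (E $ j $ k * E $ k $ j)
      - 2 * (w z)^3 * (E $ k $ j * (E $ k $ k - E $ j $ j))" for E
    unfolding \<phi>_def by algebra
  then show ?thesis
    by (simp add: sum.distrib sum_subtractf sum_distrib_left[symmetric] B_sums)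
qed

text \<open>The summand is the second derivative of \<open>w\<close> along \<open>E\<close>, so
  \<open>w\<close> is harmonic; the identity also makes the gradients of \<open>w\<close> and
  \<open>d\<close> orthogonal.\<close>

lemma sum_\<phi>_\<psi>: "(\<Sum>E\<in>B. \<phi> E z * \<psi> E z) = 0"
proof -
  have "\<phi> E z * \<psi> E z = w z * (E $ k $ k - E $ j $ j)^2 + 2 * (w z)^3 * (E $ k $ j)^2
      + (E $ j $ k * (E $ k $ k - E $ j $ j)) - 2 * w z * (E $ j $ k * E $ k $ j)
      - 3 * (w z)^2 * (E $ k $ j * (E $ k $ k - E $ j $ j))" for E
    unfolding \<phi>_def \<psi>_def by algebra
  then show ?thesis
    by (simp add: sum.distrib sum_subtractf sum_distrib_left[symmetric] B_sums)
qed

lemma sum_\<psi>_\<psi>: "(\<Sum>E\<in>B. (\<psi> E z)^2) = -2"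
proof -
  have "(\<psi> E z)^2 = (E $ k $ k - E $ j $ j)^2 + 4 * (w z)^2 * (E $ k $ j)^2
      - 4 * w z * (E $ k $ j * (E $ k $ k - E $ j $ j))" for E
    unfolding \<psi>_def by algebra
  then show ?thesis
    by (simp add: sum.distrib sum_subtractf sum_distrib_left[symmetric] B_sums)
qed

text \<open>Since \<open>g\<close> has derivative \<open>- d z * E $ k $ j\<close>, the gradients of
  \<open>w\<close> and \<open>g\<close> have product \<open>d\<close>. Together with
  \<open>sum_\<psi>_\<psi>\<close> this also makes \<open>d\<close> harmonic.\<close>

lemma sum_\<phi>_entry: "(\<Sum>E\<in>B. \<phi> E z * E $ k $ j) = -1"
proof -
  have "\<phi> E z * E $ k $ j = E $ j $ k * E $ k $ j + w z * (E $ k $ j * (E $ k $ k - E $ j $ j))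
      - (w z)^2 * (E $ k $ j)^2" for E
    unfolding \<phi>_def by algebra
  then show ?thesis
    by (simp add: sum.distrib sum_subtractf sum_distrib_left[symmetric] B_sums)
qed

text \<open>Up to the factor \<open>- d z\<close>, this is the harmonicity of
  \<open>g\<close>.\<close>

lemma sum_\<psi>_entry: "(\<Sum>E\<in>B. \<psi> E z * E $ k $ j) = 0"
proof -
  have "\<psi> E z * E $ k $ j = E $ k $ j * (E $ k $ k - E $ j $ j) - 2 * w z * (E $ k $ j)^2" for E
    unfolding \<psi>_def by algebra
  then show ?thesis
    by (simp add: sum.distrib sum_subtractf sum_distrib_left[symmetric] B_sums)
qed

text \<open>The sign sits inside \<open>poly (- b)\<close>, so that the result is again built from
  sums, products and polynomials and can be differentiated by the same rules.\<close>

lemma frame_derivative_normal_form: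
  fixes a b c :: "complex poly"
  shows "frame_derivative_on G W (\<lambda>z. poly a (w z) + poly b (w z) * g z + poly c (w z) * d z)
    (\<lambda>A z. poly (pderiv a) (w z) * \<phi> A z + poly (pderiv b) (w z) * \<phi> A z * g z
      + poly (- b) (w z) * d z * A $ k $ j + poly (pderiv c) (w z) * \<phi> A z * d z
      + poly c (w z) * d z * \<psi> A z)"
  by (rule frame_derivative_on_cong[OF frame_derivative_on_add[OF frame_derivative_on_add[OF
        frame_derivative_on_poly[OF frame_derivative_w]
        frame_derivative_on_mult[OF frame_derivative_on_poly[OF frame_derivative_w] frame_derivative_g]]
        frame_derivative_on_mult[OF frame_derivative_on_poly[OF frame_derivative_w] frame_derivative_d]] W])
     (auto simp: algebra_simps)

text \<open>As \<open>w\<close>, \<open>g\<close> and \<open>d\<close> are harmonic, only products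
  of gradients count. Those of \<open>w\<close> with itself and with \<open>d\<close> vanish, and
  that of \<open>w\<close> with \<open>g\<close> is \<open>d\<close>; the factor \<open>2\<close>
  comes from the product rule.\<close>

lemma laplace_beltrami_normal_form:
  fixes a b c :: "complex poly"
  assumes f: "\<And>z. z \<in> W \<Longrightarrow> f z = poly a (w z) + poly b (w z) * g z + poly c (w z) * d z" and z: "z \<in> W"
  shows "laplace_beltrami G f z = 2 * poly (pderiv b) (w z) * d z"
proof -
  let ?F = "\<lambda>A z. poly (pderiv a) (w z) * \<phi> A z + poly (pderiv b) (w z) * \<phi> A z * g z
      + poly (- b) (w z) * d z * A $ k $ j + poly (pderiv c) (w z) * \<phi> A z * d z
      + poly c (w z) * d z * \<psi> A z"
  let ?G = "\<lambda>A C z. (poly (pderiv (pderiv a)) (w z) * \<phi> C z * \<phi> A z + poly (pderiv a) (w z) * (\<psi> A z * \<phi> C z))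
      + (poly (pderiv (pderiv b)) (w z) * \<phi> C z * \<phi> A z * g z + poly (pderiv b) (w z) * (\<psi> A z * \<phi> C z) * g z
         - poly (pderiv b) (w z) * \<phi> A z * d z * C $ k $ j)
      + (- (poly (pderiv b) (w z)) * \<phi> C z * d z - poly b (w z) * d z * \<psi> C z) * A $ k $ j
      + (poly (pderiv (pderiv c)) (w z) * \<phi> C z * \<phi> A z * d z + poly (pderiv c) (w z) * (\<psi> A z * \<phi> C z) * d z
         + poly (pderiv c) (w z) * \<phi> A z * d z * \<psi> C z)
      + (poly (pderiv c) (w z) * \<phi> C z * d z * \<psi> A z + poly c (w z) * d z * \<psi> C z * \<psi> A z
         - 2 * poly c (w z) * d z * A $ k $ j * \<phi> C z)"
  have F: "frame_derivative_on G W f ?F"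
    by (rule frame_derivative_on_cong[OF frame_derivative_normal_form[of a b c] W]) (simp_all add: f)
  note rules = frame_derivative_on_add frame_derivative_on_mult frame_derivative_on_const
    frame_derivative_on_poly frame_derivative_w frame_derivative_g frame_derivative_d
    frame_derivative_\<phi> frame_derivative_\<psi>
  have G: "frame_derivative_on G W (?F A) (?G A)" for A
    by (rule frame_derivative_on_cong[OF _ W refl], (rule rules)+) (simp add: pderiv_minus algebra_simps)
  \<comment> \<open>For equal directions the second derivative is a combination of five quadratic
    expressions in \<open>E\<close> whose sums over \<open>B\<close> are known.\<close>
  have "?G E E z = (poly (pderiv (pderiv a)) (w z) + poly (pderiv (pderiv b)) (w z) * g z
        + poly (pderiv (pderiv c)) (w z) * d z) * (\<phi> E z)^2
      + (poly (pderiv a) (w z) + poly (pderiv b) (w z) * g z + 3 * poly (pderiv c) (w z) * d z) * (\<phi> E z * \<psi> E z)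
      - (2 * poly (pderiv b) (w z) * d z + 2 * poly c (w z) * d z) * (\<phi> E z * E $ k $ j)
      - poly b (w z) * d z * (\<psi> E z * E $ k $ j) + poly c (w z) * d z * (\<psi> E z)^2" for E
    by (simp add: algebra_simps power2_eq_square)
  then have "(\<Sum>E\<in>B. ?G E E z) = 2 * poly (pderiv b) (w z) * d z"
    by (simp add: sum.distrib sum_subtractf sum_distrib_left[symmetric] sum_\<phi>_\<phi> sum_\<phi>_\<psi> sum_\<psi>_\<psi>
        sum_\<phi>_entry sum_\<psi>_entry)
  then show ?thesis
    using laplace_beltrami_eq[OF B W z F G] by simp
qed

lemma smooth_on_normal_form:
  fixes a b c :: "complex poly"
  assumes f: "\<And>z. z \<in> W \<Longrightarrow> f z = poly a (w z) + poly b (w z) * g z + poly c (w z) * d z"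
  shows "smooth_on G W f"
proof -
  have "smooth_on G W (\<lambda>z. poly a (w z) + poly b (w z) * g z + poly c (w z) * d z)"
    by (intro smooth_on_algebra function_algebra.add function_algebra.mult function_algebra_poly
        function_algebra.generator) auto
  then show ?thesis
    unfolding smooth_on_def using f by (auto intro: Ck_on_cong[OF W, rotated])
qed

text \<open>The Laplacian has the same normal form with zero coefficient of \<open>g\<close>, so a
  second application gives zero; \<open>z0\<close> witnesses that the first does not.\<close>

lemma proper_biharmonic_normal_form:
  fixes a b c :: "complex poly"
  assumes f: "\<And>z. z \<in> W \<Longrightarrow> f z = poly a (w z) + poly b (w z) * g z + poly c (w z) * d z"
    and z0: "z0 \<in> W" "poly (pderiv b) (w z0) \<noteq> 0" "d z0 \<noteq> 0"
  shows "proper_biharmonic_on G W f"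
proof -
  have 1: "laplace_beltrami G f z = poly 0 (w z) + poly 0 (w z) * g z + poly (smult 2 (pderiv b)) (w z) * d z"
    if "z \<in> W" for z
    using laplace_beltrami_normal_form[OF f that] by simp
  have "laplace_beltrami G (laplace_beltrami G f) z = 0" if "z \<in> W" for z
    using laplace_beltrami_normal_form[OF 1 that] by simp
  moreover have "laplace_beltrami G f z0 \<noteq> 0"
    using laplace_beltrami_normal_form[OF f z0(1)] z0 by simp
  ultimately show ?thesis
    unfolding proper_biharmonic_on_def
    using W smooth_on_normal_form[OF f] z0(1) by (auto simp: numeral_2_eq_2)
qed

end

section \<open>Frames of U(2) and SU(2)\<close>

lemma unitary_groupI: "z ** conj_transpose z = mat 1 \<Longrightarrow> z \<in> unitary_group"
  using invertible_right_inverse by (auto simp: unitary_group_def)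

lemma unitary_subgroup_unitary_group: "unitary_subgroup unitary_group"
proof
  fix z w :: "complex^'a^'a" assume "z \<in> unitary_group" "w \<in> unitary_group"
  then have "z ** conj_transpose z = mat 1" "w ** conj_transpose w = mat 1"
    by (auto simp: unitary_group_def)
  moreover have "(z ** w) ** conj_transpose (z ** w) = z ** (w ** conj_transpose w) ** conj_transpose z"
    by (simp add: conj_transpose_mult matrix_mul_assoc)
  ultimately show "z ** w \<in> unitary_group"
    by (intro unitary_groupI) simp
next
  fix z :: "complex^'a^'a" assume "z \<in> unitary_group"
  then have "conj_transpose z ** z = mat 1"
    using matrix_left_right_inverse by (auto simp: unitary_group_def)
  then show "conj_transpose z \<in> unitary_group"
    by (intro unitary_groupI) simp
qed (auto intro: unitary_groupI)

lemma unitary_subgroup_special_unitary_group: "unitary_subgroup (special_unitary_group :: (complex^'n::finite^'n) set)"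
proof
  interpret U: unitary_subgroup "unitary_group :: (complex^'n^'n) set"
    by (rule unitary_subgroup_unitary_group)
  show "(mat 1 :: complex^'n^'n) \<in> special_unitary_group"
    using U.one_closed by (simp add: special_unitary_group_def)
  show "z ** w \<in> special_unitary_group"
    if "z \<in> special_unitary_group" "w \<in> special_unitary_group" for z w :: "complex^'n^'n"
    using that U.mult_closed by (simp add: special_unitary_group_def det_mul)
  show "conj_transpose z \<in> special_unitary_group" if z: "z \<in> special_unitary_group" for z :: "complex^'n^'n"
  proof -
    have "det (z ** conj_transpose z) = 1"
      using z U.mult_conj_transpose[of z] by (simp add: special_unitary_group_def)
    then have "det z * det (conj_transpose z) = 1"
      by (simp add: det_mul)
    then show ?thesis
      using z U.inv_closed by (simp add: special_unitary_group_def)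
  qed
qed (auto simp: special_unitary_group_def)

text \<open>If \<open>M\<close> is skew-Hermitian and \<open>M ** M = - mat 1\<close>, this is the one-parameter group \<open>exp (\<theta> M)\<close>.\<close>

definition rotation :: "complex^'n::finite^'n \<Rightarrow> real \<Rightarrow> complex^'n^'n" where
  "rotation M \<theta> = cos \<theta> *\<^sub>R mat 1 + sin \<theta> *\<^sub>R M"

lemma rotation_0: "rotation M 0 = mat 1"
  by (simp add: rotation_def)

lemma has_vector_derivative_rotation: "(rotation M has_vector_derivative M) (at 0)"
  unfolding rotation_def[abs_def] by (auto intro!: derivative_eq_intros)

lemma rotation_unitary:
  assumes "conj_transpose M = - M" "M ** M = - mat 1"
  shows "rotation M \<theta> \<in> unitary_group"
proof (rule unitary_groupI)
  have conj: "conj_transpose (rotation M \<theta>) = cos \<theta> *\<^sub>R mat 1 - sin \<theta> *\<^sub>R M"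
    by (simp add: rotation_def assms(1)
        linear_add[OF bounded_linear.linear[OF bounded_linear_conj_transpose]]
        linear_scale[OF bounded_linear.linear[OF bounded_linear_conj_transpose]])
  have "rotation M \<theta> ** conj_transpose (rotation M \<theta>) = ((cos \<theta>)\<^sup>2 + (sin \<theta>)\<^sup>2) *\<^sub>R mat 1"
    unfolding conj unfolding rotation_def scaleR_add_left
    by (simp add: assms(2) matrix_mult.add_left matrix_mult.diff_right matrix_mult.scaleR_left
        matrix_mult.scaleR_right scaleR_right_diff_distrib scaleR_add_right power2_eq_square mult.commute
        del: sin_cos_squared_add sin_cos_squared_add2)
  then show "rotation M \<theta> ** conj_transpose (rotation M \<theta>) = mat 1"
    by simp
qed

section \<open>Explicit orthonormal frames\<close>

definition matrix2 :: "complex \<Rightarrow> complex \<Rightarrow> complex \<Rightarrow> complex \<Rightarrow> complex^2^2" where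
  "matrix2 a b c d = vector [vector [a, b], vector [c, d]]"

lemma matrix2_nth [simp]:
  "matrix2 a b c d $ 1 $ 1 = a" "matrix2 a b c d $ 1 $ 2 = b"
  "matrix2 a b c d $ 2 $ 1 = c" "matrix2 a b c d $ 2 $ 2 = d"
  by (simp_all add: matrix2_def)

text \<open>These four are i times the identity and i times the three Pauli matrices.\<close>

definition "u2_scalar = matrix2 \<i> 0 0 \<i>"
definition "u2_diagonal = matrix2 \<i> 0 0 (- \<i>)"
definition "u2_real = matrix2 0 1 (- 1) 0"
definition "u2_imaginary = matrix2 0 \<i> \<i> 0"

lemmas u2_defs = u2_scalar_def u2_diagonal_def u2_real_def u2_imaginary_def
lemmas matrix2_simps = vec_eq_iff forall_2 conj_transpose_def matrix_matrix_mult_def sum_2 mat_def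

lemma u2_skew:
  "M \<in> {u2_scalar, u2_diagonal, u2_real, u2_imaginary} \<Longrightarrow> conj_transpose M = - M"
  by (auto simp: u2_defs matrix2_simps)

lemma u2_square:
  "M \<in> {u2_scalar, u2_diagonal, u2_real, u2_imaginary} \<Longrightarrow> M ** M = - mat 1"
  by (auto simp: u2_defs matrix2_simps)

lemma scaleR_entry: "(c *\<^sub>R A) $ i $ j = complex_of_real c * A $ i $ j"
  unfolding vector_scaleR_component by (rule scaleR_conv_of_real)

lemma det_rotation:
  assumes "M \<in> {u2_diagonal, u2_real, u2_imaginary}"
  shows "det (rotation M \<theta>) = 1"
proof -
  have "complex_of_real (cos \<theta>) * of_real (cos \<theta>) + of_real (sin \<theta>) * of_real (sin \<theta>) = 1"
    unfolding of_real_mult[symmetric] of_real_add[symmetric] by (simp flip: power2_eq_square)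
  then show ?thesis
    using assms by (auto simp: u2_defs rotation_def det_2 mat_def scaleR_entry algebra_simps simp del: vector_scaleR_component)
qed

lemma rotation_special_unitary:
  "M \<in> {u2_diagonal, u2_real, u2_imaginary} \<Longrightarrow> rotation M \<theta> \<in> special_unitary_group"
  using rotation_unitary[OF u2_skew u2_square] det_rotation by (auto simp: special_unitary_group_def)

lemma lie_algebra_rotation:
  assumes "\<And>\<theta>. rotation M \<theta> \<in> G"
  shows "M \<in> lie_algebra G"
  using assms rotation_0 has_vector_derivative_rotation
  unfolding lie_algebra_def tangent_space_def by (intro CollectI exI[of _ "rotation M"]) auto

text \<open>The factor normalises: each frame matrix has squared norm 2.\<close>

definition "su2_basis = (*\<^sub>R) (1 / sqrt 2) ` {u2_diagonal, u2_real, u2_imaginary}"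
definition "u2_basis = insert ((1 / sqrt 2) *\<^sub>R u2_scalar) su2_basis"

lemma u2_inner:
  assumes "M \<in> {u2_scalar, u2_diagonal, u2_real, u2_imaginary}"
    "N \<in> {u2_scalar, u2_diagonal, u2_real, u2_imaginary}"
  shows "M \<bullet> N = (if M = N then 2 else 0)"
  using assms by (auto simp: u2_defs inner_vec_def sum_2 inner_complex_def matrix2_simps)

lemma skew_expansion:
  fixes A :: "complex^2^2"
  assumes "conj_transpose A = - A"
  shows "A = ((Im (A $ 1 $ 1) + Im (A $ 2 $ 2)) / 2) *\<^sub>R u2_scalar
    + ((Im (A $ 1 $ 1) - Im (A $ 2 $ 2)) / 2) *\<^sub>R u2_diagonal
    + Re (A $ 1 $ 2) *\<^sub>R u2_real + Im (A $ 1 $ 2) *\<^sub>R u2_imaginary"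
proof -
  have "cnj (A $ i $ j) = - A $ j $ i" for i j
    using assms by (simp add: vec_eq_iff conj_transpose_def)
  from this[of 1 1] this[of 2 2] this[of 1 2] have
    "Re (A $ 1 $ 1) = 0" "Re (A $ 2 $ 2) = 0"
    "Re (A $ 2 $ 1) = - Re (A $ 1 $ 2)" "Im (A $ 2 $ 1) = Im (A $ 1 $ 2)"
    by (auto simp: complex_eq_iff)
  then show ?thesis
    by (simp add: u2_defs vec_eq_iff forall_2 complex_eq_iff field_simps)
qed

text \<open>Differentiate \<open>det (\<gamma> t) = 1\<close> at the identity.\<close>

lemma trace_zero_lie_algebra_special_unitary:
  assumes "A \<in> lie_algebra (special_unitary_group :: (complex^2^2) set)"
  shows "A $ 1 $ 1 + A $ 2 $ 2 = 0"
proof -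
  interpret unitary_subgroup "special_unitary_group :: (complex^2^2) set"
    by (rule unitary_subgroup_special_unitary_group)
  obtain \<gamma> where \<gamma>: "\<And>t. \<gamma> t \<in> special_unitary_group" "\<gamma> 0 = mat 1"
    "(\<gamma> has_vector_derivative A) (at (0::real))"
    using lie_algebraE[OF assms] by blast
  have entry: "((\<lambda>t. \<gamma> t $ i $ j) has_vector_derivative A $ i $ j) (at 0)" for i j
    by (rule bounded_linear.has_vector_derivative[OF bounded_linear_compose[OF
          bounded_linear_vec_nth bounded_linear_vec_nth] \<gamma>(3)])
  have "((\<lambda>t. det (\<gamma> t)) has_vector_derivative A $ 1 $ 1 + A $ 2 $ 2) (at 0)"
    unfolding det_2
    by (rule has_vector_derivative_eq_rhs[OF has_vector_derivative_diff[OF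
          has_vector_derivative_mult[OF entry entry] has_vector_derivative_mult[OF entry entry]]])
       (simp add: \<gamma>(2) mat_def)
  moreover have "((\<lambda>t. det (\<gamma> t)) has_vector_derivative 0) (at 0)"
    using \<gamma>(1) by (simp add: special_unitary_group_def)
  ultimately show ?thesis
    by (rule vector_derivative_unique_at)
qed

lemma u2_pairwise_orthonormal:
  assumes "X \<in> u2_basis" "Y \<in> u2_basis"
  shows "scalar_product X Y = (if X = Y then 1 else 0)"
proof -
  obtain M N where XY: "X = (1 / sqrt 2) *\<^sub>R M" "Y = (1 / sqrt 2) *\<^sub>R N"
    and "M \<in> {u2_scalar, u2_diagonal, u2_real, u2_imaginary}"
      "N \<in> {u2_scalar, u2_diagonal, u2_real, u2_imaginary}"
    using assms unfolding u2_basis_def su2_basis_def by blast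
  then show ?thesis
    using u2_inner[of M N] by (simp add: scalar_product_eq_inner)
qed

text \<open>The one-parameter groups put the frame into the Lie algebra; conversely, its elements
  are skew-Hermitian and expand in the frame.\<close>

lemma orthonormal_basis_u2: "orthonormal_basis (lie_algebra unitary_group) u2_basis"
proof -
  interpret unitary_subgroup "unitary_group :: (complex^2^2) set"
    by (rule unitary_subgroup_unitary_group)
  have "M \<in> L" if "M \<in> {u2_scalar, u2_diagonal, u2_real, u2_imaginary}" for M
    using rotation_unitary[OF u2_skew u2_square] that by (intro lie_algebra_rotation) auto
  then have sub: "u2_basis \<subseteq> L"
    using subspace_lie_algebra by (auto simp: u2_basis_def su2_basis_def intro: subspace_scale)
  have "M \<in> span u2_basis" if "M \<in> {u2_scalar, u2_diagonal, u2_real, u2_imaginary}" for M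
  proof -
    have "(1 / sqrt 2) *\<^sub>R M \<in> span u2_basis"
      using that by (intro span_base) (auto simp: u2_basis_def su2_basis_def)
    from span_scale[OF this, of "sqrt 2"] show ?thesis
      by simp
  qed
  then have "L \<subseteq> span u2_basis"
    by (auto intro!: span_add span_scale intro: subst[OF skew_expansion[OF lie_algebra_skew, symmetric]])
  then show ?thesis
    unfolding orthonormal_basis_def
    using sub span_minimal[OF sub subspace_lie_algebra] u2_pairwise_orthonormal by auto
qed

lemma orthonormal_basis_su2: "orthonormal_basis (lie_algebra special_unitary_group) su2_basis"
proof -
  interpret unitary_subgroup "special_unitary_group :: (complex^2^2) set"
    by (rule unitary_subgroup_special_unitary_group)
  have "M \<in> L" if "M \<in> {u2_diagonal, u2_real, u2_imaginary}" for M
    using rotation_special_unitary that by (intro lie_algebra_rotation) auto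
  then have sub: "su2_basis \<subseteq> L"
    using subspace_lie_algebra by (auto simp: su2_basis_def intro: subspace_scale)
  have in_span: "M \<in> span su2_basis" if "M \<in> {u2_diagonal, u2_real, u2_imaginary}" for M
  proof -
    have "(1 / sqrt 2) *\<^sub>R M \<in> span su2_basis"
      using that by (intro span_base) (auto simp: su2_basis_def)
    from span_scale[OF this, of "sqrt 2"] show ?thesis
      by simp
  qed
  have "L \<subseteq> span su2_basis"
  proof
    fix A assume A: "A \<in> L"
    \<comment> \<open>Vanishing trace kills the coefficient of \<open>u2_scalar\<close> in the
      expansion.\<close>
    have "Im (A $ 1 $ 1) + Im (A $ 2 $ 2) = 0"
      using trace_zero_lie_algebra_special_unitary[OF A] by (simp add: complex_eq_iff)
    then have "A = ((Im (A $ 1 $ 1) - Im (A $ 2 $ 2)) / 2) *\<^sub>R u2_diagonal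
        + Re (A $ 1 $ 2) *\<^sub>R u2_real + Im (A $ 1 $ 2) *\<^sub>R u2_imaginary"
      using skew_expansion[OF lie_algebra_skew[OF A]] by simp
    moreover have "\<dots> \<in> span su2_basis"
      by (intro span_add span_scale in_span) auto
    ultimately show "A \<in> span su2_basis"
      by simp
  qed
  then show ?thesis
    unfolding orthonormal_basis_def
    using sub span_minimal[OF sub subspace_lie_algebra] u2_pairwise_orthonormal
    by (auto simp: u2_basis_def)
qed

text \<open>Ensures that sums over the bases, which are sets, count every frame matrix
  separately.\<close>

lemma u2_distinct:
  "distinct [u2_scalar, u2_diagonal, u2_real, u2_imaginary]"
  by (auto simp: u2_defs matrix2_simps)

lemma sum_su2_basis:
  fixes h :: "complex^2^2 \<Rightarrow> complex"
  shows "sum h su2_basis = h ((1 / sqrt 2) *\<^sub>R u2_diagonal) + h ((1 / sqrt 2) *\<^sub>R u2_real)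
    + h ((1 / sqrt 2) *\<^sub>R u2_imaginary)"
  using u2_distinct by (simp add: su2_basis_def)

lemma sum_u2_basis:
  fixes h :: "complex^2^2 \<Rightarrow> complex"
  shows "sum h u2_basis = h ((1 / sqrt 2) *\<^sub>R u2_scalar) + sum h su2_basis"
  using u2_distinct by (auto simp: u2_basis_def su2_basis_def)

text \<open>The scalar matrix has zero off-diagonal and equal diagonal entries, so it adds nothing
  and both bases give the same sums.\<close>

lemma basis_sums:
  fixes j k :: 2
  assumes "j \<noteq> k" "B = u2_basis \<or> B = su2_basis"
  shows "(\<Sum>E\<in>B. E $ j $ k * E $ k $ j) = -1" "(\<Sum>E\<in>B. (E $ k $ k - E $ j $ j)^2) = -2"
      "(\<Sum>E\<in>B. (E $ j $ k)^2) = 0" "(\<Sum>E\<in>B. (E $ k $ j)^2) = 0"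
      "(\<Sum>E\<in>B. E $ j $ k * (E $ k $ k - E $ j $ j)) = 0"
      "(\<Sum>E\<in>B. E $ k $ j * (E $ k $ k - E $ j $ j)) = 0"
proof -
  have sq: "complex_of_real (1 / sqrt 2) * of_real (1 / sqrt 2) = 1/2"
    unfolding of_real_mult[symmetric] by (simp add: field_simps)
  have jk: "j = 1 \<and> k = 2 \<or> j = 2 \<and> k = 1"
    using assms(1) exhaust_2[of j] exhaust_2[of k] by auto
  define r where "r = complex_of_real (1 / sqrt 2)"
  have r: "r * r = 1/2" "r * (r * c) = c / 2" for c
    using sq by (auto simp: r_def simp flip: mult.assoc)
  have entries: "((1 / sqrt 2) *\<^sub>R M) $ i $ l = r * M $ i $ l" for M :: "complex^2^2" and i l
    unfolding r_def by (rule scaleR_entry)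
  show "(\<Sum>E\<in>B. E $ j $ k * E $ k $ j) = -1" "(\<Sum>E\<in>B. (E $ k $ k - E $ j $ j)^2) = -2"
      "(\<Sum>E\<in>B. (E $ j $ k)^2) = 0" "(\<Sum>E\<in>B. (E $ k $ j)^2) = 0"
      "(\<Sum>E\<in>B. E $ j $ k * (E $ k $ k - E $ j $ j)) = 0"
      "(\<Sum>E\<in>B. E $ k $ j * (E $ k $ k - E $ j $ j)) = 0"
    using assms(2) jk
    by (auto simp: sum_u2_basis sum_su2_basis entries u2_defs power2_eq_square algebra_simps r simp del: vector_scaleR_component)
qed

section \<open>Quotients of matrix coefficients\<close>

lemma exhaust_5:
  fixes i :: 5
  shows "i = 1 \<or> i = 2 \<or> i = 3 \<or> i = 4 \<or> i = 5"
proof (induct i)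
  case (of_int z)
  then have "0 \<le> z" "z < 5"
    by simp_all
  \<comment> \<open>The residue \<open>0\<close> is the index \<open>5\<close>.\<close>
  then have "z = 0 \<or> z = 1 \<or> z = 2 \<or> z = 3 \<or> z = 4"
    by arith
  then show ?case
    by auto
qed

lemma UNIV_5: "UNIV = {1, 2, 3, 4, 5::5}"
  using exhaust_5 by auto

lemma sum_5: "sum f (UNIV :: 5 set) = f 1 + f 2 + f 3 + f 4 + f 5"
  unfolding UNIV_5 by (simp add: ac_simps)

lemma vector_5:
  "vector [a, b, c, d, e] $ (1::5) = a" "vector [a, b, c, d, e] $ (2::5) = b"
  "vector [a, b, c, d, e] $ (3::5) = c" "vector [a, b, c, d, e] $ (4::5) = d"
  "vector [a, b, c, d, e] $ (5::5) = (e :: 'a::zero)"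
  unfolding vector_def by simp_all

text \<open>Counting columns from zero turns the index into the exponent of the second column
  sum.\<close>

lemma column_index:
  fixes i :: 5
  obtains a where "a \<le> 4" "i = of_nat (Suc a)"
proof -
  have "\<exists>a\<in>{0, 1, 2, 3, 4}. i = of_nat (Suc a)"
    using exhaust_5[of i] by simp
  then obtain a where "a \<in> {0, 1, 2, 3, 4}" "i = of_nat (Suc a)"
    by blast
  then show ?thesis
    by (intro that[of a]) auto
qed

text \<open>Weighting column \<open>a\<close> by the powers \<open>t^4, ..., 1\<close> gives
  \<open>u^(4 - a) * v^a\<close>. The entries of \<open>p\<close> are \<open>r\<close> times these
  powers plus \<open>s\<close> times their derivatives in \<open>t\<close>, and \<open>u\<close>,
  \<open>v\<close> have as derivatives the first-row entries of \<open>z\<close>. The exponents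
  \<open>3 - a\<close> and \<open>a - 1\<close> truncate only where their coefficient is
  zero.\<close>

lemma pi4_comb_eq:
  assumes "p $ 1 = r * t^4 + 4 * s * t^3" "p $ 2 = r * t^3 + 3 * s * t^2" "p $ 3 = r * t^2 + 2 * s * t"
    "p $ 4 = r * t + s" "p $ 5 = r" and "a \<le> 4"
  defines "u z \<equiv> t * z $ 1 $ 1 + z $ 2 $ 1" and "v z \<equiv> t * z $ 1 $ 2 + z $ 2 $ 2"
  shows "pi4_comb p (of_nat (Suc a)) z = r * u z^(4 - a) * v z^a
    + s * (of_nat (4 - a) * u z^(3 - a) * v z^a * z $ 1 $ 1 + of_nat a * u z^(4 - a) * v z^(a - 1) * z $ 1 $ 2)"
proof -
  have "a = 0 \<or> a = 1 \<or> a = 2 \<or> a = 3 \<or> a = 4"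
    using \<open>a \<le> 4\<close> by auto
  then show ?thesis
    by (elim disjE)
       (simp_all add: pi4_comb_def pi4_def Let_def transpose_def sum_5 vector_5 assms(1-5) u_def v_def
         algebra_simps power2_eq_square power3_eq_cube power4_eq_xxxx)
qed


text \<open>Substitute \<open>w * (z\<^sub>1 / x) - d\<close> for \<open>z\<^sub>2 / x\<close>. The
  two terms with \<open>s\<close> then contribute \<open>4 - a\<close> and \<open>a\<close> copies
  of \<open>z\<^sub>1 / x\<close>, whence the coefficient \<open>4\<close>, and the rest is the
  \<open>d\<close> term. The condition \<open>y^b \<noteq> 0\<close> admits \<open>y = 0\<close>
  when \<open>b = 0\<close>.\<close>

lemma quotient_expansion:
  fixes x y z\<^sub>1 z\<^sub>2 r s c :: complex
  assumes "b < a" "a \<le> 4" "x \<noteq> 0" "c \<noteq> 0" "y^b \<noteq> 0"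
  defines "w \<equiv> y / x"
  defines "d \<equiv> w * (z\<^sub>1 / x) - z\<^sub>2 / x"
  shows "(r * x^(4 - a) * y^a + s * (of_nat (4 - a) * x^(3 - a) * y^a * z\<^sub>1 + of_nat a * x^(4 - a) * y^(a - 1) * z\<^sub>2))
      / (c * x^(4 - b) * y^b)
    = r / c * w^(a - b) + 4 * s / c * w^(a - b) * (z\<^sub>1 / x) + - of_nat a * s / c * w^(a - b - 1) * d"
proof -
  \<comment> \<open>Writing \<open>a = b + Suc m\<close> resolves the truncated differences
    \<open>a - b\<close> and \<open>a - b - 1\<close>.\<close>
  define m where "m = a - b - 1"
  have a: "a = b + Suc m"
    using \<open>b < a\<close> by (simp add: m_def)
  have "4 - b = (4 - a) + Suc m"
    using \<open>a \<le> 4\<close> by (simp add: a)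
  then have x: "x^(4 - b) = x^(4 - a) * x * x^m"
    by (simp add: power_add)
  \<comment> \<open>For \<open>a = 4\<close> the exponent \<open>3 - a\<close> truncates to
    \<open>0\<close>, but both sides vanish.\<close>
  have "of_nat (4 - a) * x^(3 - a) * x = of_nat (4 - a) * x^(4 - a)"
    using \<open>a \<le> 4\<close> by (cases "a = 4") (auto simp: Suc_diff_le numeral_eq_Suc simp flip: power_Suc2)
  then have x': "of_nat (4 - a) * x^(3 - a) = of_nat (4 - a) * x^(4 - a) / x"
    using \<open>x \<noteq> 0\<close> by (simp add: field_simps)
  have four: "of_nat (4 - a) = (4 - of_nat a :: complex)"
    using \<open>a \<le> 4\<close> by (simp add: of_nat_diff)
  have y: "y^a = y^b * y * y^m" "y^(a - 1) = y^b * y^m"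
    by (simp_all add: a power_add)
  have w: "w^(a - b) = y * y^m / (x * x^m)" "w^(a - b - 1) = y^m / x^m"
    by (simp_all add: a w_def power_divide)
  show ?thesis
    unfolding x y w x' unfolding four d_def w_def
    using assms(3-5) by (simp add: field_simps)
qed

lemma (in column_chart) proper_biharmonic_quotient:
  assumes f: "\<And>z. z \<in> W \<Longrightarrow> f z =
      (r * x z^(4 - a) * y z^a + s * (of_nat (4 - a) * x z^(3 - a) * y z^a * z $ 1 $ j
        + of_nat a * x z^(4 - a) * y z^(a - 1) * z $ 1 $ k)) / (c * x z^(4 - b) * y z^b)"
    and "b < a" "a \<le> 4" "c \<noteq> 0" "s \<noteq> 0" and y: "\<And>z. z \<in> W \<Longrightarrow> y z^b \<noteq> 0"
    and z0: "z0 \<in> W" "y z0 \<noteq> 0"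
  shows "proper_biharmonic_on G W f"
proof (rule proper_biharmonic_normal_form)
  show "f z = poly (monom (r / c) (a - b)) (w z) + poly (monom (4 * s / c) (a - b)) (w z) * g z
      + poly (monom (- of_nat a * s / c) (a - b - 1)) (w z) * d z" if "z \<in> W" for z
    using quotient_expansion[OF assms(2,3) x_nonzero[OF that] \<open>c \<noteq> 0\<close> y[OF that]]
    by (simp add: f that poly_monom w_def g_def d_def)
  show "z0 \<in> W"
    by (rule z0)
  \<comment> \<open>The value is a nonzero multiple of a power of \<open>w z0\<close>, and
    \<open>y z0 \<noteq> 0\<close> keeps that power from vanishing.\<close>
  show "poly (pderiv (monom (4 * s / c) (a - b))) (w z0) \<noteq> 0"
    using assms(2,4,5) z0 x_nonzero[OF z0(1)] by (simp add: pderiv_monom poly_monom w_def)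
  have "invertible z0"
    using z0(1) W unitary openin_subset by (fastforce simp: unitary_group_def)
  then have "z0 $ 1 $ 1 * z0 $ 2 $ 2 - z0 $ 1 $ 2 * z0 $ 2 $ 1 \<noteq> 0"
    by (simp add: invertible_det_nz det_2)
  moreover have "j = 1 \<and> k = 2 \<or> j = 2 \<and> k = 1"
    using jk exhaust_2[of j] exhaust_2[of k] by auto
  \<comment> \<open>The two sides differ by \<open>det z0\<close> up to sign.\<close>
  ultimately have "y z0 * z0 $ 1 $ j \<noteq> x z0 * z0 $ 1 $ k"
    by (auto simp: x_def y_def algebra_simps)
  then show "d z0 \<noteq> 0"
    using x_nonzero[OF z0(1)] by (simp add: d_def w_def g_def field_simps)
qed

text \<open>The common setting for U(2) and SU(2); the rotations generated by \<open>u2_real\<close>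
  serve the density of the domain.\<close>

locale u2_subgroup = unitary_subgroup G for G :: "(complex^2^2) set" +
  fixes B
  assumes rotation_closed: "\<And>\<theta>. rotation u2_real \<theta> \<in> G"
    and B: "orthonormal_basis (lie_algebra G) B"
    and B_cases: "B = u2_basis \<or> B = su2_basis"
begin

text \<open>Right multiplication by a rotation mixes the two columns, so that two column sums not both zero
  become nonzero for small angles.\<close>

lemma column_sums_nonzero_dense:
  assumes "z \<in> G"
  shows "z \<in> closure {z \<in> G. t * z $ 1 $ 1 + z $ 2 $ 1 \<noteq> 0 \<and> t * z $ 1 $ 2 + z $ 2 $ 2 \<noteq> 0}"
    (is "z \<in> closure ?S")
proof -
  define u v where "u = t * z $ 1 $ 1 + z $ 2 $ 1" and "v = t * z $ 1 $ 2 + z $ 2 $ 2"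
  have "z $ 1 $ 1 * z $ 2 $ 2 - z $ 1 $ 2 * z $ 2 $ 1 \<noteq> 0"
    using assms unitary by (auto simp: unitary_group_def invertible_det_nz det_2)
  moreover have "z $ 1 $ 1 * z $ 2 $ 2 - z $ 1 $ 2 * z $ 2 $ 1 = z $ 1 $ 1 * v - z $ 1 $ 2 * u"
    by (simp add: u_def v_def algebra_simps)
  ultimately have uv: "u \<noteq> 0 \<or> v \<noteq> 0"
    by auto
  show ?thesis
  proof (cases "u \<noteq> 0 \<and> v \<noteq> 0")
    case True
    then show ?thesis
      using assms by (intro closure_subset[THEN subsetD]) (auto simp: u_def v_def)
  next
    case False
    have rot: "(rotation u2_real \<longlongrightarrow> rotation u2_real 0) (at_right 0)"
      unfolding rotation_def[abs_def] by (intro tendsto_intros)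
    have lim: "((\<lambda>\<theta>. z ** rotation u2_real \<theta>) \<longlongrightarrow> z) (at_right 0)"
      using matrix_mult.tendsto[OF tendsto_const[of z] rot] by (simp add: rotation_0)
    have ev: "z ** rotation u2_real \<theta> \<in> ?S" if "0 < \<theta>" "\<theta> < pi / 2" for \<theta>
    proof -
      let ?z = "z ** rotation u2_real \<theta>"
      have "sin \<theta> \<noteq> 0" "cos \<theta> \<noteq> 0"
        using that sin_gt_zero[of \<theta>] cos_gt_zero[of \<theta>] by auto
      moreover have "t * ?z $ 1 $ 1 + ?z $ 2 $ 1 = u * of_real (cos \<theta>) - v * of_real (sin \<theta>)"
        "t * ?z $ 1 $ 2 + ?z $ 2 $ 2 = u * of_real (sin \<theta>) + v * of_real (cos \<theta>)"
        by (simp_all add: rotation_def u2_real_def matrix_matrix_mult_def sum_2 mat_def scaleR_entry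
            u_def v_def algebra_simps del: vector_scaleR_component)
      \<comment> \<open>Exactly one of \<open>u\<close> and \<open>v\<close> is zero here, so each
        rotated sum is a single nonzero term.\<close>
      ultimately show ?thesis
        using uv False mult_closed[OF assms rotation_closed] by auto
    qed
    have "\<forall>\<^sub>F \<theta> in at_right 0. z ** rotation u2_real \<theta> \<in> ?S"
      by (rule eventually_at_rightI[of 0 "pi / 2"]) (use ev in auto)
    then have "\<forall>\<^sub>F \<theta> in at_right 0. z ** rotation u2_real \<theta> \<in> closure ?S"
      by (rule eventually_mono) (rule subsetD[OF closure_subset])
    then show ?thesis
      using lim by (intro Lim_in_closed_set[OF closed_closure]) auto
  qed
qed

lemma column_chartI:
  assumes "openin (top_of_set G) W" "j \<noteq> k" "\<And>z. z \<in> W \<Longrightarrow> t * z $ 1 $ j + z $ 2 $ j \<noteq> 0"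
  shows "column_chart G W B j k t"
  by unfold_locales (use assms B basis_sums[OF assms(2) B_cases] in auto)

lemma proper_biharmonic_pi4:
  fixes \<alpha> \<beta> :: 5 and p q :: "complex^5"
  assumes "\<alpha> \<noteq> \<beta>" and "c \<noteq> 0" "s \<noteq> 0"
    and p: "p $ 1 = r * t^4 + 4 * s * t^3" "p $ 2 = r * t^3 + 3 * s * t^2"
      "p $ 3 = r * t^2 + 2 * s * t" "p $ 4 = r * t + s" "p $ 5 = r"
    and q: "q $ 1 = c * t^4" "q $ 2 = c * t^3" "q $ 3 = c * t^2" "q $ 4 = c * t" "q $ 5 = c"
  defines "W \<equiv> {z \<in> G. pi4_comb q \<beta> z \<noteq> 0}"
  shows "openin (top_of_set G) W" "G \<subseteq> closure W"
    "proper_biharmonic_on G W (\<lambda>z. pi4_comb p \<alpha> z / pi4_comb q \<beta> z)"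
proof -
  obtain a where a: "a \<le> 4" "\<alpha> = of_nat (Suc a)"
    by (rule column_index)
  obtain b where b: "b \<le> 4" "\<beta> = of_nat (Suc b)"
    by (rule column_index)
  define u v where "u z = t * z $ 1 $ 1 + z $ 2 $ 1" and "v z = t * z $ 1 $ 2 + z $ 2 $ 2"
    for z :: "complex^2^2"
  have P: "pi4_comb p \<alpha> z = r * u z^(4 - a) * v z^a + s * (of_nat (4 - a) * u z^(3 - a) * v z^a * z $ 1 $ 1
      + of_nat a * u z^(4 - a) * v z^(a - 1) * z $ 1 $ 2)" for z
    using pi4_comb_eq[OF p a(1)] a(2) by (simp add: u_def v_def)
  \<comment> \<open>Entries proportional to the powers of \<open>t\<close> are the case
    \<open>s = 0\<close>.\<close>
  have Q: "pi4_comb q \<beta> z = c * u z^(4 - b) * v z^b" for z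
    using pi4_comb_eq[of q c t 0 b z] q b by (simp add: u_def v_def)
  have "continuous_on G (pi4_comb q \<beta>)"
    unfolding Q[abs_def] u_def[abs_def] v_def[abs_def] by (intro continuous_intros)
  then show W: "openin (top_of_set G) W"
    using continuous_openin_preimage_gen[of G "pi4_comb q \<beta>" "- {0}"]
    by (simp add: W_def vimage_def Int_def open_Compl)
  have sub: "{z \<in> G. u z \<noteq> 0 \<and> v z \<noteq> 0} \<subseteq> W"
    using \<open>c \<noteq> 0\<close> by (auto simp: W_def Q)
  have dense: "G \<subseteq> closure {z \<in> G. u z \<noteq> 0 \<and> v z \<noteq> 0}"
    using column_sums_nonzero_dense[of _ t] by (auto simp: u_def v_def)
  then show "G \<subseteq> closure W"
    using closure_mono[OF sub] by blast
  have "{z \<in> G. u z \<noteq> 0 \<and> v z \<noteq> 0} \<noteq> {}"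
    using dense one_closed by fastforce
  then obtain z0 where z0: "z0 \<in> W" "u z0 \<noteq> 0" "v z0 \<noteq> 0"
    using sub by blast
  have "a \<noteq> b"
    using \<open>\<alpha> \<noteq> \<beta>\<close> a(2) b(2) by blast
  then consider "b < a" | "a < b"
    by linarith
  then show "proper_biharmonic_on G W (\<lambda>z. pi4_comb p \<alpha> z / pi4_comb q \<beta> z)"
  proof cases
    case 1
    \<comment> \<open>Since \<open>b < a \<le> 4\<close>, the exponent \<open>4 - b\<close> is
      positive, so a nonzero denominator forces \<open>u z \<noteq> 0\<close>. For
      \<open>b = 0\<close> the sum \<open>v z\<close> may vanish, hence only its power is
      recorded.\<close>
    have nz: "u z \<noteq> 0" "v z^b \<noteq> 0" if "z \<in> W" for z
      using that 1 a(1) by (auto simp: W_def Q)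
    interpret column_chart G W B 1 2 t
      using W nz(1) by (intro column_chartI) (auto simp: u_def)
    have "x = u" "y = v"
      by (auto simp: fun_eq_iff x_def y_def u_def v_def)
    then show ?thesis
      using 1 a(1) \<open>c \<noteq> 0\<close> \<open>s \<noteq> 0\<close> nz(2) z0
      by (intro proper_biharmonic_quotient[of _ r a s c b z0]) (auto simp: P Q)
  next
    case 2
    have nz: "v z \<noteq> 0" "u z^(4 - b) \<noteq> 0" if "z \<in> W" for z
      using that 2 by (auto simp: W_def Q)
    interpret column_chart G W B 2 1 t
      using W nz(1) by (intro column_chartI) (auto simp: v_def)
    have xy: "x = v" "y = u"
      by (auto simp: fun_eq_iff x_def y_def u_def v_def)
    \<comment> \<open>Exchanging the columns replaces \<open>a\<close> and \<open>b\<close> by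
      \<open>4 - a\<close> and \<open>4 - b\<close>.\<close>
    have "4 - (4 - a) = a" "3 - (4 - a) = a - 1" "4 - a - 1 = 3 - a" "4 - (4 - b) = b"
      using a(1) b(1) by auto
    then show ?thesis
      using 2 b(1) \<open>c \<noteq> 0\<close> \<open>s \<noteq> 0\<close> nz(2) z0
      by (intro proper_biharmonic_quotient[of _ r "4 - a" s c "4 - b" z0])
         (auto simp: P Q xy algebra_simps)
  qed
qed

end

lemma u2_subgroup_unitary_group: "u2_subgroup unitary_group u2_basis"
proof -
  interpret unitary_subgroup "unitary_group :: (complex^2^2) set"
    by (rule unitary_subgroup_unitary_group)
  show ?thesis
    by unfold_locales (auto intro: rotation_unitary u2_skew u2_square orthonormal_basis_u2)
qed

lemma u2_subgroup_special_unitary_group: "u2_subgroup special_unitary_group su2_basis"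
proof -
  interpret unitary_subgroup "special_unitary_group :: (complex^2^2) set"
    by (rule unitary_subgroup_special_unitary_group)
  show ?thesis
    by unfold_locales (auto intro: rotation_special_unitary orthonormal_basis_su2)
qed

theorem theorem7p1:
  fixes \<alpha> \<beta> :: 5 and p q :: "complex^5"
  assumes "\<alpha> \<noteq> \<beta>"
    and "p $ 4 * q $ 5 \<noteq> p $ 5 * q $ 4"
    and "p $ 1 * (q $ 5)^4 = (q $ 4)^3 * (4 * p $ 4 * q $ 5 - 3 * p $ 5 * q $ 4)"
    and "q $ 1 * (q $ 5)^3 = (q $ 4)^4"
    and "p $ 2 * (q $ 5)^3 = (q $ 4)^2 * (3 * p $ 4 * q $ 5 - 2 * p $ 5 * q $ 4)"
    and "q $ 2 * (q $ 5)^2 = (q $ 4)^3"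
    and "p $ 3 * (q $ 5)^2 = q $ 4 * (2 * p $ 4 * q $ 5 - p $ 5 * q $ 4)"
    and "q $ 3 * q $ 5 = (q $ 4)^2"
  shows
    "let P = pi4_comb p \<alpha>; Q = pi4_comb q \<beta>;
         W = {z \<in> unitary_group. Q z \<noteq> 0};
         f = (\<lambda>z. P z / Q z)
     in openin (top_of_set unitary_group) W \<and> unitary_group \<subseteq> closure W \<and>
        proper_biharmonic_on unitary_group W f \<and>
        proper_biharmonic_on special_unitary_group (W \<inter> special_unitary_group) f"
proof -
  \<comment> \<open>If \<open>q $ 5 = 0\<close>, the equation for \<open>q $ 1\<close> forces
    \<open>q $ 4 = 0\<close>, against the inequality assumed for \<open>p\<close> and
    \<open>q\<close>.\<close>
  have q5: "q $ 5 \<noteq> 0"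
  proof
    assume "q $ 5 = 0"
    then have "q $ 4 = 0"
      using assms(4) by simp
    then show False
      using assms(2) \<open>q $ 5 = 0\<close> by simp
  qed
  \<comment> \<open>Read from entry 5 upwards, \<open>q\<close> is a geometric progression with
    ratio \<open>t\<close>; \<open>s\<close> measures how far \<open>p\<close> is from being
    proportional to it.\<close>
  define t where "t = q $ 4 / q $ 5"
  define s where "s = p $ 4 - p $ 5 * t"
  have q4: "q $ 4 = q $ 5 * t"
    using q5 by (simp add: t_def)
  have p4: "p $ 4 = p $ 5 * t + s"
    by (simp add: s_def)
  have s: "s \<noteq> 0"
    using assms(2) q5 by (auto simp: s_def t_def field_simps)
  have q: "q $ 1 = q $ 5 * t^4" "q $ 2 = q $ 5 * t^3" "q $ 3 = q $ 5 * t^2"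
    using assms(4,6,8) q5 by (simp_all add: t_def field_simps eval_nat_numeral)
  \<comment> \<open>Keeping the powers of \<open>q $ 5\<close> makes these polynomial identities;
    they are cancelled afterwards.\<close>
  have "p $ 1 * (q $ 5)^4 = (p $ 5 * t^4 + 4 * s * t^3) * (q $ 5)^4"
    unfolding assms(3) q4 p4 by algebra
  moreover have "p $ 2 * (q $ 5)^3 = (p $ 5 * t^3 + 3 * s * t^2) * (q $ 5)^3"
    unfolding assms(5) q4 p4 by algebra
  moreover have "p $ 3 * (q $ 5)^2 = (p $ 5 * t^2 + 2 * s * t) * (q $ 5)^2"
    unfolding assms(7) q4 p4 by algebra
  ultimately have p: "p $ 1 = p $ 5 * t^4 + 4 * s * t^3" "p $ 2 = p $ 5 * t^3 + 3 * s * t^2"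
    "p $ 3 = p $ 5 * t^2 + 2 * s * t"
    using q5 by simp_all
  \<comment> \<open>As SU(2) lies in U(2), the restricted domain is the nonvanishing set of the
    denominator taken in SU(2) itself.\<close>
  have W: "{z \<in> unitary_group. pi4_comb q \<beta> z \<noteq> 0} \<inter> special_unitary_group
      = {z \<in> special_unitary_group. pi4_comb q \<beta> z \<noteq> 0}"
    by (auto simp: special_unitary_group_def)
  show ?thesis
    unfolding Let_def W
    using u2_subgroup.proper_biharmonic_pi4[OF u2_subgroup_unitary_group assms(1) q5 s p p4 refl q q4 refl]
      u2_subgroup.proper_biharmonic_pi4(3)[OF u2_subgroup_special_unitary_group assms(1) q5 s p p4 refl q q4 refl]
    by blast
qed

end
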